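(* Let $p$ be a prime, $e\geq 1$ an integer, $A,B\in\mathbb{Z}/p^e\mathbb{Z}$ with $-(4A^3+27B^2)$ a unit, and $E=E_{A,B}(\mathbb{Z}/p^e\mathbb{Z})$. Let $\mathsf{f}\in\mathbb{Z}[x]$ be an infinity polynomial for $E$. Then $$0 \to \big\langle \big(p:1:\mathsf{f}(p)\big) \big\rangle \xrightarrow{\iota} E_{A,B}(\mathbb{Z}/p^e\mathbb{Z}) \xrightarrow{\pi} E_{A,B}(\mathbb{F}_p) \to 0$$ is a short exact sequence of groups, where $\iota$ is the inclusion and $\pi$ the reduction modulo $p$. In other words, the kernel of $\pi$ is the cyclic group generated by $(p:1:\mathsf{f}(p))$.
   Context: For a commutative ring $R$, $\mathbb{P}^2(R)$ is the set of triples in $R^3$ generating the unit ideal modulo multiplication by units; $(X:Y:Z)$ denotes a class. For $A,B\in R$ with $-(4A^3+27B^2)\in R^*$, $E_{A,B}(R)=\{(X:Y:Z)\in\mathbb{P}^2(R): Y^2Z=X^3+AXZ^2+BZ^3\}$, with the standard group law (Bosma–Lenstra addition laws) having neutral element $\mathcal{O}=(0:1:0)$; reduction modulo $p$, $\pi:E_{A,B}(\mathbb{Z}/p^e\mathbb{Z})\to E_{A,B}(\mathbb{F}_p)$, is a surjective group homomorphism. Points of $E=E_{A,B}(\mathbb{Z}/p^e\mathbb{Z})$ not of the form $(X:Y:1)$ are the points at infinity, forming $E^\infty$; each can be written as $(X:1:Z)$ with $X,Z\in p(\mathbb{Z}/p^e\mathbb{Z})$. A polynomial $\mathsf{f}\in\mathbb{Z}[x]$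 is called an infinity polynomial for $E$ if every $P\in E^\infty$ equals $(X:1:\mathsf{f}(X))$ for some $X\in p(\mathbb{Z}/p^e\mathbb{Z})$ (such a polynomial exists).
   Formalization: The prime p is assumed odd: for p = 2 the curve over F_2 always has a rational singular point S (e.g. (0:1:1) for A=0, B=1) at which all addition laws vanish on (S,S), so E(F_2) carries no group law and the sequence of groups is undefined. *)

theory Defs
  imports
    "HOL-Number_Theory.Residues"
    "HOL-Algebra.Exact_Sequence"
    "HOL-Computational_Algebra.Polynomial"
begin

section \<open>The projective plane over a commutative ring\<close>

context
  fixes R :: "('a, 'b) ring_scheme" (structure)
begin

definition primitive_triples :: "('a \<times> 'a \<times> 'a) set"
  where "primitive_triples =
    {(x, y, z). x \<in> carrier R \<and> y \<in> carrier R \<and> z \<in> carrier R \<and>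
       genideal R {x, y, z} = carrier R}"

definition scale :: "'a \<Rightarrow> 'a \<times> 'a \<times> 'a \<Rightarrow> 'a \<times> 'a \<times> 'a"
  where "scale u = (\<lambda>(x, y, z). (u \<otimes> x, u \<otimes> y, u \<otimes> z))"

definition proj_rel :: "(('a \<times> 'a \<times> 'a) \<times> ('a \<times> 'a \<times> 'a)) set"
  where "proj_rel =
    {(s, t). s \<in> primitive_triples \<and> t \<in> primitive_triples \<and> (\<exists>u\<in>Units R. t = scale u s)}"

definition proj_plane :: "('a \<times> 'a \<times> 'a) set set"
  where "proj_plane = primitive_triples // proj_rel"

definition proj_point :: "'a \<Rightarrow> 'a \<Rightarrow> 'a \<Rightarrow> ('a \<times> 'a \<times> 'a) set"
  where "proj_point x y z = proj_rel `` {(x, y, z)}"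


section \<open>Elliptic curves in short Weierstrass form\<close>

definition weierstrass_disc :: "'a \<Rightarrow> 'a \<Rightarrow> 'a"
  where "weierstrass_disc A B =
    \<ominus> ([(4::nat)] \<cdot> (A [^] (3::nat)) \<oplus> [(27::nat)] \<cdot> (B [^] (2::nat)))"

definition weierstrass_eq :: "'a \<Rightarrow> 'a \<Rightarrow> 'a \<times> 'a \<times> 'a \<Rightarrow> bool"
  where "weierstrass_eq A B = (\<lambda>(x, y, z).
    y [^] (2::nat) \<otimes> z = x [^] (3::nat) \<oplus> A \<otimes> x \<otimes> z [^] (2::nat) \<oplus> B \<otimes> z [^] (3::nat))"

definition curve_points :: "'a \<Rightarrow> 'a \<Rightarrow> ('a \<times> 'a \<times> 'a) set set"
  where "curve_points A B = {P \<in> proj_plane. \<forall>t\<in>P. weierstrass_eq A B t}"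

text \<open>
  The three addition laws of bidegree \<open>(2, 2)\<close> of Lange--Ruppert and Bosma--Lenstra, which
  form a basis of the space of all addition laws of that bidegree. Each of them
  computes the sum of two points wherever its value is primitive. Below, \<open>xyp\<close> and
  \<open>xym\<close> stand for the symmetric and the antisymmetric combination of
  \<open>x1 y2\<close> and \<open>x2 y1\<close>, and similarly for the other pairs of coordinates.
\<close>

definition add_law1 ::
  "'a \<Rightarrow> 'a \<Rightarrow> 'a \<times> 'a \<times> 'a \<Rightarrow> 'a \<times> 'a \<times> 'a \<Rightarrow> 'a \<times> 'a \<times> 'a"
  where "add_law1 A B = (\<lambda>(x1, y1, z1) (x2, y2, z2).
    let xx = x1 \<otimes> x2; yy = y1 \<otimes> y2; zz = z1 \<otimes> z2;
        xym = x1 \<otimes> y2 \<ominus> x2 \<otimes> y1;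
        xzp = x1 \<otimes> z2 \<oplus> x2 \<otimes> z1; xzm = x1 \<otimes> z2 \<ominus> x2 \<otimes> z1;
        yzp = y1 \<otimes> z2 \<oplus> y2 \<otimes> z1; yzm = y1 \<otimes> z2 \<ominus> y2 \<otimes> z1
    in (xym \<otimes> yzp \<oplus> xzm \<otimes> yy \<ominus> A \<otimes> xzp \<otimes> xzm \<ominus> [(3::nat)] \<cdot> B \<otimes> xzm \<otimes> zz,
        \<ominus> ([(3::nat)] \<cdot> xx \<otimes> xym) \<ominus> yy \<otimes> yzm \<ominus> A \<otimes> xym \<otimes> zz
          \<oplus> A \<otimes> xzp \<otimes> yzm \<oplus> [(3::nat)] \<cdot> B \<otimes> yzm \<otimes> zz,
        [(3::nat)] \<cdot> xx \<otimes> xzm \<ominus> yzp \<otimes> yzm \<oplus> A \<otimes> xzm \<otimes> zz))"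

definition add_law2 ::
  "'a \<Rightarrow> 'a \<Rightarrow> 'a \<times> 'a \<times> 'a \<Rightarrow> 'a \<times> 'a \<times> 'a \<Rightarrow> 'a \<times> 'a \<times> 'a"
  where "add_law2 A B = (\<lambda>(x1, y1, z1) (x2, y2, z2).
    let xx = x1 \<otimes> x2; yy = y1 \<otimes> y2; zz = z1 \<otimes> z2;
        xyp = x1 \<otimes> y2 \<oplus> x2 \<otimes> y1;
        xzp = x1 \<otimes> z2 \<oplus> x2 \<otimes> z1;
        yzp = y1 \<otimes> z2 \<oplus> y2 \<otimes> z1
    in (yy \<otimes> xyp \<ominus> A \<otimes> xx \<otimes> yzp \<ominus> A \<otimes> xyp \<otimes> xzp \<ominus> [(3::nat)] \<cdot> B \<otimes> xyp \<otimes> zz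
          \<ominus> [(3::nat)] \<cdot> B \<otimes> xzp \<otimes> yzp \<oplus> A [^] (2::nat) \<otimes> yzp \<otimes> zz,
        yy [^] (2::nat) \<oplus> [(3::nat)] \<cdot> A \<otimes> xx [^] (2::nat) \<oplus> [(9::nat)] \<cdot> B \<otimes> xx \<otimes> xzp
          \<ominus> A [^] (2::nat) \<otimes> (x1 \<otimes> z2) \<otimes> (x1 \<otimes> z2 \<oplus> [(2::nat)] \<cdot> (x2 \<otimes> z1))
          \<ominus> A [^] (2::nat) \<otimes> (x2 \<otimes> z1) \<otimes> ([(2::nat)] \<cdot> (x1 \<otimes> z2) \<oplus> x2 \<otimes> z1)
          \<ominus> [(3::nat)] \<cdot> A \<otimes> B \<otimes> zz \<otimes> xzp
          \<ominus> (A [^] (3::nat) \<oplus> [(9::nat)] \<cdot> (B [^] (2::nat))) \<otimes> zz [^] (2::nat),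
        [(3::nat)] \<cdot> xx \<otimes> xyp \<oplus> yy \<otimes> yzp \<oplus> A \<otimes> xyp \<otimes> zz \<oplus> A \<otimes> xzp \<otimes> yzp
          \<oplus> [(3::nat)] \<cdot> B \<otimes> yzp \<otimes> zz))"

definition add_law3 ::
  "'a \<Rightarrow> 'a \<Rightarrow> 'a \<times> 'a \<times> 'a \<Rightarrow> 'a \<times> 'a \<times> 'a \<Rightarrow> 'a \<times> 'a \<times> 'a"
  where "add_law3 A B = (\<lambda>(x1, y1, z1) (x2, y2, z2).
    let xx = x1 \<otimes> x2; yy = y1 \<otimes> y2; zz = z1 \<otimes> z2;
        xyp = x1 \<otimes> y2 \<oplus> x2 \<otimes> y1; xym = x1 \<otimes> y2 \<ominus> x2 \<otimes> y1;
        xzp = x1 \<otimes> z2 \<oplus> x2 \<otimes> z1; xzm = x1 \<otimes> z2 \<ominus> x2 \<otimes> z1;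
        yzm = y1 \<otimes> z2 \<ominus> y2 \<otimes> z1
    in (xyp \<otimes> xym \<oplus> A \<otimes> xx \<otimes> xzm \<oplus> [(3::nat)] \<cdot> B \<otimes> xzp \<otimes> xzm
          \<ominus> A [^] (2::nat) \<otimes> xzm \<otimes> zz,
        xym \<otimes> yy \<ominus> [(3::nat)] \<cdot> A \<otimes> xx \<otimes> yzm \<oplus> A \<otimes> xyp \<otimes> xzm
          \<oplus> [(3::nat)] \<cdot> B \<otimes> xym \<otimes> zz \<ominus> [(3::nat)] \<cdot> B \<otimes> xzp \<otimes> yzm
          \<oplus> A [^] (2::nat) \<otimes> yzm \<otimes> zz,
        \<ominus> (xyp \<otimes> yzm) \<ominus> xzm \<otimes> yy \<ominus> A \<otimes> xzp \<otimes> xzm \<ominus> [(3::nat)] \<cdot> B \<otimes> xzm \<otimes> zz))"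

definition lin_comb3 ::
  "'a \<Rightarrow> 'a \<times> 'a \<times> 'a \<Rightarrow> 'a \<Rightarrow> 'a \<times> 'a \<times> 'a \<Rightarrow> 'a \<Rightarrow> 'a \<times> 'a \<times> 'a \<Rightarrow> 'a \<times> 'a \<times> 'a"
  where "lin_comb3 a s b t c u =
    (case (s, t, u) of ((s1, s2, s3), (t1, t2, t3), (u1, u2, u3)) \<Rightarrow>
      (a \<otimes> s1 \<oplus> b \<otimes> t1 \<oplus> c \<otimes> u1, a \<otimes> s2 \<oplus> b \<otimes> t2 \<oplus> c \<otimes> u2, a \<otimes> s3 \<oplus> b \<otimes> t3 \<oplus> c \<otimes> u3))"

text \<open>
  The three laws agree up to scaling, so over a local ring the primitive linear combinations of
  their values (one of which is primitive when the curve is elliptic) make up exactly one class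
  in the projective plane.
\<close>

definition curve_add ::
  "'a \<Rightarrow> 'a \<Rightarrow> ('a \<times> 'a \<times> 'a) set \<Rightarrow> ('a \<times> 'a \<times> 'a) set \<Rightarrow> ('a \<times> 'a \<times> 'a) set"
  where "curve_add A B P Q =
    {r \<in> primitive_triples. \<exists>s\<in>P. \<exists>t\<in>Q. \<exists>a\<in>carrier R. \<exists>b\<in>carrier R. \<exists>c\<in>carrier R.
       r = lin_comb3 a (add_law1 A B s t) b (add_law2 A B s t) c (add_law3 A B s t)}"

definition curve_group :: "'a \<Rightarrow> 'a \<Rightarrow> ('a \<times> 'a \<times> 'a) set monoid"
  where "curve_group A B =
    \<lparr>carrier = curve_points A B, monoid.mult = curve_add A B, one = proj_point \<zero> \<one> \<zero>\<rparr>"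

definition points_at_infinity :: "'a \<Rightarrow> 'a \<Rightarrow> ('a \<times> 'a \<times> 'a) set set"
  where "points_at_infinity A B =
    {P \<in> curve_points A B. \<not> (\<exists>x\<in>carrier R. \<exists>y\<in>carrier R. P = proj_point x y \<one>)}"

end


section \<open>Curves modulo a prime power\<close>

text \<open>
  \<^const>\<open>residue_ring\<close> \<open>m\<close> has the carrier \<open>{0..m - 1}\<close>, so the image in it of an integer \<open>k\<close> is
  \<open>k mod m\<close>. In particular \<open>p\<close> itself is written \<open>p mod p ^ e\<close>, which is \<open>0\<close> if \<open>e = 1\<close>.
\<close>

definition infinity_point :: "int \<Rightarrow> nat \<Rightarrow> int poly \<Rightarrow> int \<Rightarrow> (int \<times> int \<times> int) set"
  where "infinity_point p e f x = proj_point (residue_ring (p ^ e)) x 1 (poly f x mod p ^ e)"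

definition infinity_polynomial :: "int \<Rightarrow> nat \<Rightarrow> int \<Rightarrow> int \<Rightarrow> int poly \<Rightarrow> bool"
  where "infinity_polynomial p e A B f \<longleftrightarrow>
    (\<forall>P\<in>points_at_infinity (residue_ring (p ^ e)) A B.
       \<exists>x\<in>cgenideal (residue_ring (p ^ e)) (p mod p ^ e). P = infinity_point p e f x)"

definition reduce_point :: "int \<Rightarrow> (int \<times> int \<times> int) set \<Rightarrow> (int \<times> int \<times> int) set"
  where "reduce_point p P =
    proj_rel (residue_ring p) `` ((\<lambda>(x, y, z). (x mod p, y mod p, z mod p)) ` P)"

end

(*
  Associativity of the group law over Z/p^e is transferred from the complex numbers. Every point
  modulo p^e has homogeneous coordinates (a s : t : s^3) with t^2 = d modulo p^e, where
  d = a^3 + A a s^4 + B s^6, and the integer a may be changed by multiples of p^e. Over the complex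
  numbers (a s : w : s^3) with w a square root of d is a point of the curve with the x-coordinate
  a / s^2. A polynomial identity with integer coefficients that holds for all choices of the signs
  of the square roots holds for the formal square roots, hence modulo p^e. So it suffices to treat
  three points whose x-coordinates are in general position, where only chords occur.

  The kernel of the reduction consists of the points (X : 1 : Z) with X, Z divisible by p, and Z is
  determined by X. If p^k divides the X-coordinates of two such points, then the X-coordinate of
  their sum is the sum of the X-coordinates modulo p^(3k). So the multiple p^(k-1) of a point with
  X = p has an X-coordinate of valuation exactly k, and any point of the kernel can be cancelled
  step by step by multiples of that point.
*)

theory Submission
  imports Defs Complex_Main
begin

section \<open>Addition laws and chords\<close>

text \<open>Slopes cannot be formed modulo p^e, where differences of coordinates may be zero
  divisors, and a point modulo p^e need not lift to a rational point of the curve; hence the formal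
  square roots. A direct check of associativity would be a polynomial identity of degree (6, 8, 6)
  in the coordinates of the three points, modulo three cubics; over a field a geometric argument
  with chords replaces it. A single addition law may vanish modulo p on some pairs of points, so a
  sum is described by all three laws together, and proportionality of triples takes the place of
  equality. The condition p \<noteq> 2 belongs to smoothness: in characteristic 2 every short
  Weierstrass cubic is singular, although 4 A^3 + 27 B^2 may be a unit.\<close>

definition smul :: "'a::comm_ring_1 \<Rightarrow> 'a \<times> 'a \<times> 'a \<Rightarrow> 'a \<times> 'a \<times> 'a"
  where "smul u = (\<lambda>(x, y, z). (u * x, u * y, u * z))"

text \<open>Vanishing of the minors expresses proportionality without naming a factor; being a
  polynomial condition, it transfers from the complex numbers to residues.\<close>

definition cross :: "'a::comm_ring_1 \<times> 'a \<times> 'a \<Rightarrow> 'a \<times> 'a \<times> 'a \<Rightarrow> 'a \<times> 'a \<times> 'a"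
  where "cross = (\<lambda>(x1, y1, z1) (x2, y2, z2).
    (y1 * z2 - z1 * y2, z1 * x2 - x1 * z2, x1 * y2 - y1 * x2))"

definition cubic :: "'a::comm_ring_1 \<Rightarrow> 'a \<Rightarrow> 'a \<times> 'a \<times> 'a \<Rightarrow> 'a"
  where "cubic A B = (\<lambda>(x, y, z). y^2 * z - (x^3 + A * x * z^2 + B * z^3))"

definition law1 :: "'a::comm_ring_1 \<Rightarrow> 'a \<Rightarrow> 'a \<times> 'a \<times> 'a \<Rightarrow> 'a \<times> 'a \<times> 'a \<Rightarrow> 'a \<times> 'a \<times> 'a"
  where "law1 A B = (\<lambda>(x1, y1, z1) (x2, y2, z2).
    let xx = x1 * x2; yy = y1 * y2; zz = z1 * z2;
        xym = x1 * y2 - x2 * y1;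
        xzp = x1 * z2 + x2 * z1; xzm = x1 * z2 - x2 * z1;
        yzp = y1 * z2 + y2 * z1; yzm = y1 * z2 - y2 * z1
    in (xym * yzp + xzm * yy - A * xzp * xzm - 3 * B * xzm * zz,
        - (3 * xx * xym) - yy * yzm - A * xym * zz + A * xzp * yzm + 3 * B * yzm * zz,
        3 * xx * xzm - yzp * yzm + A * xzm * zz))"

definition law2 :: "'a::comm_ring_1 \<Rightarrow> 'a \<Rightarrow> 'a \<times> 'a \<times> 'a \<Rightarrow> 'a \<times> 'a \<times> 'a \<Rightarrow> 'a \<times> 'a \<times> 'a"
  where "law2 A B = (\<lambda>(x1, y1, z1) (x2, y2, z2).
    let xx = x1 * x2; yy = y1 * y2; zz = z1 * z2;
        xyp = x1 * y2 + x2 * y1;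
        xzp = x1 * z2 + x2 * z1;
        yzp = y1 * z2 + y2 * z1
    in (yy * xyp - A * xx * yzp - A * xyp * xzp - 3 * B * xyp * zz
          - 3 * B * xzp * yzp + A^2 * yzp * zz,
        yy^2 + 3 * A * xx^2 + 9 * B * xx * xzp
          - A^2 * (x1 * z2) * (x1 * z2 + 2 * (x2 * z1))
          - A^2 * (x2 * z1) * (2 * (x1 * z2) + x2 * z1)
          - 3 * A * B * zz * xzp - (A^3 + 9 * B^2) * zz^2,
        3 * xx * xyp + yy * yzp + A * xyp * zz + A * xzp * yzp + 3 * B * yzp * zz))"

definition law3 :: "'a::comm_ring_1 \<Rightarrow> 'a \<Rightarrow> 'a \<times> 'a \<times> 'a \<Rightarrow> 'a \<times> 'a \<times> 'a \<Rightarrow> 'a \<times> 'a \<times> 'a"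
  where "law3 A B = (\<lambda>(x1, y1, z1) (x2, y2, z2).
    let xx = x1 * x2; yy = y1 * y2; zz = z1 * z2;
        xyp = x1 * y2 + x2 * y1; xym = x1 * y2 - x2 * y1;
        xzp = x1 * z2 + x2 * z1; xzm = x1 * z2 - x2 * z1;
        yzm = y1 * z2 - y2 * z1
    in (xyp * xym + A * xx * xzm + 3 * B * xzp * xzm - A^2 * xzm * zz,
        xym * yy - 3 * A * xx * yzm + A * xyp * xzm + 3 * B * xym * zz - 3 * B * xzp * yzm
          + A^2 * yzm * zz,
        - (xyp * yzm) - xzm * yy - A * xzp * xzm - 3 * B * xzm * zz))"

text \<open>All indices above \<open>1\<close> stand for the third law, so that no range condition is needed.\<close>

definition law :: "nat \<Rightarrow> 'a::comm_ring_1 \<Rightarrow> 'a \<Rightarrow> 'a \<times> 'a \<times> 'a \<Rightarrow> 'a \<times> 'a \<times> 'a \<Rightarrow> 'a \<times> 'a \<times> 'a"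
  where "law i = (if i = 0 then law1 else if i = 1 then law2 else law3)"

lemmas law_defs = law_def law1_def law2_def law3_def Let_def

lemma law_cases:
  assumes "P law1" "P law2" "P law3"
  shows "P (law i)"
  using assms by (auto simp: law_def)

lemma law_smul: "law i (A :: 'a::idom) B (smul u s) (smul v t) = smul (u^2 * v^2) (law i A B s t)"
  apply (rule law_cases[of "\<lambda>l. l A B (smul u s) (smul v t) = smul (u^2 * v^2) (l A B s t)"])
proof -
  obtain x y z x' y' z' where st: "s = (x, y, z)" "t = (x', y', z')" by (cases s; cases t)
  show "law1 A B (smul u s) (smul v t) = smul (u^2 * v^2) (law1 A B s t)"
    unfolding st by (simp add: law_defs smul_def; intro conjI; Groebner_Basis.algebra)
  show "law2 A B (smul u s) (smul v t) = smul (u^2 * v^2) (law2 A B s t)"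
    unfolding st by (simp add: law_defs smul_def; intro conjI; Groebner_Basis.algebra)
  show "law3 A B (smul u s) (smul v t) = smul (u^2 * v^2) (law3 A B s t)"
    unfolding st by (simp add: law_defs smul_def; intro conjI; Groebner_Basis.algebra)
qed

lemma cubic_smul: "cubic (A :: 'a::idom) B (smul u s) = u^3 * cubic A B s"
proof -
  obtain x y z where s: "s = (x, y, z)" by (cases s)
  show ?thesis unfolding s cubic_def smul_def prod.case by Groebner_Basis.algebra
qed

section \<open>Chord addition over a field\<close>

fun chord :: "'a::field \<times> 'a \<Rightarrow> 'a \<times> 'a \<Rightarrow> 'a \<times> 'a"
  where "chord (x1, y1) (x2, y2) =
    (let l = (y2 - y1) / (x2 - x1); x3 = l^2 - x1 - x2 in (x3, l * (x1 - x3) - y1))"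

definition on_curve :: "'a::comm_ring_1 \<Rightarrow> 'a \<Rightarrow> 'a \<times> 'a \<Rightarrow> bool"
  where "on_curve A B = (\<lambda>(x, y). y^2 = x^3 + A * x + B)"

text \<open>Two points with distinct x-coordinates determine the curve. Eliminating y2, A and B
  leaves x1, x2, y1 and the slope l as free parameters, so that claims about chords become
  polynomial identities without side conditions.\<close>

lemma chord_params:
  fixes A B :: "'a::field"
  assumes "on_curve A B (x1, y1)" "on_curve A B (x2, y2)" "x1 \<noteq> x2"
    and l: "l = (y2 - y1) / (x2 - x1)"
  shows "y2 = y1 + l * (x2 - x1)"
    and "A = l * (2 * y1 + l * (x2 - x1)) - x1^2 - x1 * x2 - x2^2"
    and "B = y1^2 - x1^3 - A * x1"
proof -
  show y2: "y2 = y1 + l * (x2 - x1)" using assms by (simp add: field_simps)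
  show "B = y1^2 - x1^3 - A * x1" using assms by (simp add: on_curve_def)
  have "(x2 - x1) * A = (x2 - x1) * (l * (2 * y1 + l * (x2 - x1)) - x1^2 - x1 * x2 - x2^2)"
  proof -
    have "(x2 - x1) * A - (x2 - x1) * (l * (2 * y1 + l * (x2 - x1)) - x1^2 - x1 * x2 - x2^2) =
      (y1^2 - (x1^3 + A * x1 + B)) - ((y1 + l * (x2 - x1))^2 - (x2^3 + A * x2 + B))" by Groebner_Basis.algebra
    then show ?thesis using assms(1,2) by (simp add: on_curve_def flip: y2)
  qed
  then show "A = l * (2 * y1 + l * (x2 - x1)) - x1^2 - x1 * x2 - x2^2"
    using assms(3) by simp
qed

lemma chord_on_curve:
  fixes A B :: "'a::field"
  assumes "on_curve A B P" "on_curve A B Q" "fst P \<noteq> fst Q"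
  shows "on_curve A B (chord P Q)"
proof -
  obtain x1 y1 x2 y2 where PQ: "P = (x1, y1)" "Q = (x2, y2)" by (cases P; cases Q)
  define l where "l = (y2 - y1) / (x2 - x1)"
  note * = chord_params[OF _ _ _ l_def, of A B]
  have A: "A = l * (2 * y1 + l * (x2 - x1)) - x1^2 - x1 * x2 - x2^2"
    and B: "B = y1^2 - x1^3 - A * x1" using * assms PQ by simp_all
  show ?thesis
    unfolding PQ on_curve_def chord.simps l_def[symmetric] Let_def prod.case B unfolding A
    by Groebner_Basis.algebra
qed

lemma law_chord:
  fixes A B :: "'a::field"
  assumes "on_curve A B (x1, y1)" "on_curve A B (x2, y2)" "x1 \<noteq> x2"
  shows "\<exists>k. law i A B (x1, y1, 1) (x2, y2, 1) =
    smul k (fst (chord (x1, y1) (x2, y2)), snd (chord (x1, y1) (x2, y2)), 1)"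
proof -
  define l where "l = (y2 - y1) / (x2 - x1)"
  note * = chord_params[OF assms l_def]
  define x3 where "x3 = l^2 - x1 - x2"
  have "\<exists>k. law i A B (x1, y1, 1) (x2, y2, 1) = smul k (x3, l * (x1 - x3) - y1, 1)"
    \<comment> \<open>The target has third coordinate 1, so the only possible factor is the third
      coordinate of the law. It may be zero where that law is exceptional.\<close>
    apply (rule exI[of _ "snd (snd (law i A B (x1, y1, 1) (x2, y2, 1)))"])
    unfolding x3_def *(3) unfolding *(2) unfolding *(1)
    apply (rule law_cases[of "\<lambda>l. l _ _ _ _ = smul (snd (snd (l _ _ _ _))) _"])
    by (simp add: law_defs smul_def; intro conjI; Groebner_Basis.algebra)+
  then show ?thesis by (simp add: x3_def l_def Let_def)
qed

lemma chord_commute: "fst P \<noteq> fst Q \<Longrightarrow> chord P Q = chord Q P" for P Q :: "'a::field \<times> 'a"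
proof -
  assume ne: "fst P \<noteq> fst Q"
  obtain x1 y1 x2 y2 where PQ: "P = (x1, y1)" "Q = (x2, y2)" by (cases P; cases Q)
  define l where "l = (y2 - y1) / (x2 - x1)"
  have l: "(y1 - y2) / (x1 - x2) = l" unfolding l_def by (metis minus_diff_eq minus_divide_divide)
  have y2: "y2 = y1 + l * (x2 - x1)" using ne PQ by (simp add: l_def field_simps)
  show ?thesis unfolding PQ chord.simps l_def[symmetric] l Let_def
    by (simp add: y2) Groebner_Basis.algebra
qed

text \<open>Vieta's formulas for the cubic restricted to the line y = l x + m, whose third
  intersection is the negative of the sum; \<open>A - 2 * l * m\<close> is the second elementary
  symmetric function of the three roots.\<close>

lemma chord_line:
  fixes A B :: "'a::field"
  assumes P: "on_curve A B (x1, y1)" "on_curve A B (x2, y2)" "x1 \<noteq> x2"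
    and x3: "chord (x1, y1) (x2, y2) = (x3, y3)"
  obtains l m where "y1 = l * x1 + m" "y2 = l * x2 + m" "- y3 = l * x3 + m"
    "x3 = l^2 - x1 - x2" "A - 2 * l * m = x1 * x2 + x3 * (x1 + x2)"
    "\<And>x. x^3 + A * x + B - (l * x + m)^2 = (x - x1) * (x - x2) * (x - x3)"
proof -
  define l where "l = (y2 - y1) / (x2 - x1)"
  define m where "m = y1 - l * x1"
  note * = chord_params[OF P l_def]
  have x3: "x3 = l^2 - x1 - x2" and y3: "y3 = l * (x1 - x3) - y1"
    using x3 by (auto simp: l_def Let_def)
  show thesis
  proof (rule that)
    show "y1 = l * x1 + m" by (simp add: m_def)
    show "y2 = l * x2 + m" using *(1) by (simp add: m_def algebra_simps)
    show "- y3 = l * x3 + m" by (simp add: m_def y3 algebra_simps)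
    show "x3 = l^2 - x1 - x2" by fact
    show "A - 2 * l * m = x1 * x2 + x3 * (x1 + x2)"
      unfolding *(2) m_def x3 by Groebner_Basis.algebra
    show "x^3 + A * x + B - (l * x + m)^2 = (x - x1) * (x - x2) * (x - x3)" for x
      unfolding *(3) unfolding *(2) m_def x3 by Groebner_Basis.algebra
  qed
qed

text \<open>
  The function \<open>x\<^sup>2 + b x + c + a y\<close> has divisor \<open>P\<^sub>1 + P\<^sub>2 + P\<^sub>3 + T - 4 O\<close>, where \<open>- T\<close> is the
  sum of the three points. It is the product of the lines through \<open>P\<^sub>1, P\<^sub>2\<close> and through
  \<open>P\<^sub>1 + P\<^sub>2, P\<^sub>3\<close>, divided by the vertical line through \<open>P\<^sub>1 + P\<^sub>2\<close>.
\<close>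

lemma chord_chord_function:
  fixes A B :: "'a::field"
  assumes P: "on_curve A B (x1, y1)" "on_curve A B (x2, y2)" "on_curve A B (x3, y3)"
    and ne: "x1 \<noteq> x2" "x1 \<noteq> x3" "x2 \<noteq> x3" "fst (chord (x1, y1) (x2, y2)) \<noteq> x3"
    and T: "chord (chord (x1, y1) (x2, y2)) (x3, y3) = (xT, yT)"
  obtains a b c where
    "x1^2 + b * x1 + c + a * y1 = 0" "x2^2 + b * x2 + c + a * y2 = 0" "x3^2 + b * x3 + c + a * y3 = 0"
    "xT^2 + b * xT + c - a * yT = 0" "xT = a^2 - 2 * b - x1 - x2 - x3"
proof -
  obtain xq yq where q: "chord (x1, y1) (x2, y2) = (xq, yq)" by force
  obtain l m where l: "y1 = l * x1 + m" "y2 = l * x2 + m" "- yq = l * xq + m"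
    "xq = l^2 - x1 - x2" "A - 2 * l * m = x1 * x2 + xq * (x1 + x2)"
    using chord_line[OF P(1,2) ne(1) q] by metis
  have Q: "on_curve A B (xq, yq)" using chord_on_curve[OF P(1,2)] ne(1) q by simp
  have ne': "xq \<noteq> x3" using ne(4) q by simp
  obtain l' m' where l': "yq = l' * xq + m'" "y3 = l' * x3 + m'" "- yT = l' * xT + m'"
    "xT = l'^2 - xq - x3" "A - 2 * l' * m' = xq * x3 + xT * (xq + x3)"
    using chord_line[OF Q P(3) ne' T[unfolded q]] by metis
  \<comment> \<open>Multiply y - l x - m by y - l' x - m' and replace y^2 by x^3 + A x + B. Since m
    + m' = - (l + l') xq, the coefficient of y is - (l + l') (x - xq); synthetic division of the
    rest by x - xq yields b and c.\<close>
  define a where "a = - (l + l')"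
  define b where "b = xq + l * l'"
  define c where "c = A + l * m' + l' * m + xq * b"
  have "m = - yq - l * xq" by (simp add: l(3))
  then have m: "m = - (l * xq) - l' * xq - m'" by (simp add: l'(1))
  have A: "A = 2 * l * m + x1 * x2 + xq * (x1 + x2)" using l(5) by (simp add: algebra_simps)
  have A': "A = 2 * l' * m' + xq * x3 + xT * (xq + x3)" using l'(5) by (simp add: algebra_simps)
  have x12: "x2 = l^2 - x1 - xq" using l(4) by simp
  have x3T: "x3 = l'^2 - xq - xT" using l'(4) by simp
  \<comment> \<open>On either line the function becomes a monic quadratic in x with the two expected
    roots.\<close>
  have on_l: "x^2 + b * x + c + a * (l * x + m) = (x - x1) * (x - x2)" for x
    unfolding a_def b_def c_def A unfolding m x12 by Groebner_Basis.algebra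
  have on_l': "x^2 + b * x + c + a * (l' * x + m') = (x - x3) * (x - xT)" for x
    unfolding a_def b_def c_def A' unfolding m x3T by Groebner_Basis.algebra
  show thesis
  proof (rule that)
    show "x1^2 + b * x1 + c + a * y1 = 0" using on_l[of x1] l(1) by simp
    show "x2^2 + b * x2 + c + a * y2 = 0" using on_l[of x2] l(2) by simp
    show "x3^2 + b * x3 + c + a * y3 = 0" using on_l'[of x3] l'(2) by simp
    show "xT^2 + b * xT + c - a * yT = 0" using on_l'[of xT] l'(3) 
      by (metis diff_conv_add_uminus mult_minus_right cancel_comm_monoid_add_class.diff_cancel mult_zero_right)
    show "xT = a^2 - 2 * b - x1 - x2 - x3"
      unfolding a_def b_def l'(4) x12 by Groebner_Basis.algebra
  qed
qed

text \<open>The functions obtained from the two bracketings both have leading term x^2 and vanish at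
  the three given points. Their difference is linear in x and y and vanishes at three points that
  are not collinear, so it is zero, and the fourth zeros agree as well.\<close>

lemma chord_assoc:
  fixes A B :: "'a::field"
  assumes P: "on_curve A B (x1, y1)" "on_curve A B (x2, y2)" "on_curve A B (x3, y3)"
    and ne: "x1 \<noteq> x2" "x1 \<noteq> x3" "x2 \<noteq> x3"
      "fst (chord (x1, y1) (x2, y2)) \<noteq> x3" "fst (chord (x2, y2) (x3, y3)) \<noteq> x1"
  shows "chord (chord (x1, y1) (x2, y2)) (x3, y3) = chord (x1, y1) (chord (x2, y2) (x3, y3))"
proof -
  obtain xT yT where T: "chord (chord (x1, y1) (x2, y2)) (x3, y3) = (xT, yT)" by force
  obtain xS yS where S: "chord (chord (x2, y2) (x3, y3)) (x1, y1) = (xS, yS)" by force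
  obtain a b c where abc:
    "x1^2 + b * x1 + c + a * y1 = 0" "x2^2 + b * x2 + c + a * y2 = 0" "x3^2 + b * x3 + c + a * y3 = 0"
    "xT^2 + b * xT + c - a * yT = 0" "xT = a^2 - 2 * b - x1 - x2 - x3"
    using chord_chord_function[OF P ne(1-4) T] by metis
  obtain a' b' c' where abc':
    "x2^2 + b' * x2 + c' + a' * y2 = 0" "x3^2 + b' * x3 + c' + a' * y3 = 0" "x1^2 + b' * x1 + c' + a' * y1 = 0"
    "xS^2 + b' * xS + c' - a' * yS = 0" "xS = a'^2 - 2 * b' - x2 - x3 - x1"
    using chord_chord_function[OF P(2,3,1) ne(3) _ _ ne(5) S] ne by metis
  have lin0: "(a - a') * y + (b - b') * x + (c - c') = 0"
    if "x^2 + b * x + c + a * y = 0" "x^2 + b' * x + c' + a' * y = 0" for x y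
  proof -
    have "(a - a') * y + (b - b') * x + (c - c') =
      (x^2 + b * x + c + a * y) - (x^2 + b' * x + c' + a' * y)" by Groebner_Basis.algebra
    then show ?thesis using that by simp
  qed
  have lin: "(a - a') * y1 + (b - b') * x1 + (c - c') = 0"
    "(a - a') * y2 + (b - b') * x2 + (c - c') = 0" "(a - a') * y3 + (b - b') * x3 + (c - c') = 0"
    using abc(1-3) abc'(1-3) by (blast intro: lin0)+
  \<comment> \<open>Otherwise the difference would be an equation of the line through the first two
    points, and x3 would be a root of the cubic on that line: x1, x2 or the x-coordinate of their
    sum.\<close>
  have aa: "a = a'"
  proof (rule ccontr)
    assume "a \<noteq> a'"
    obtain xq yq where q: "chord (x1, y1) (x2, y2) = (xq, yq)" by force
    obtain l m where l: "y1 = l * x1 + m" "y2 = l * x2 + m"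
      "\<And>x. x^3 + A * x + B - (l * x + m)^2 = (x - x1) * (x - x2) * (x - xq)"
      using chord_line[OF P(1,2) ne(1) q] by metis
    define d where "d = a - a'"
    have d: "d \<noteq> 0" using \<open>a \<noteq> a'\<close> by (simp add: d_def)
    have 1: "(d * l + (b - b')) * x1 + (d * m + (c - c')) = 0"
      and 2: "(d * l + (b - b')) * x2 + (d * m + (c - c')) = 0"
      using lin(1,2) l(1,2) by (simp_all add: d_def algebra_simps)
    have "(d * l + (b - b')) * (x1 - x2) = 0" using 1 2 by (metis add_diff_cancel_right right_diff_distrib diff_self)
    then have dl: "d * l + (b - b') = 0" using ne(1) by simp
    then have dm: "d * m + (c - c') = 0" using 1 by simp
    have "d * (y3 - (l * x3 + m)) = (d * y3 + (b - b') * x3 + (c - c'))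
      - (d * l + (b - b')) * x3 - (d * m + (c - c'))" by Groebner_Basis.algebra
    then have "d * (y3 - (l * x3 + m)) = 0" using dl dm lin(3) d_def by simp
    then have "y3 = l * x3 + m" using d by simp
    then have "(x3 - x1) * (x3 - x2) * (x3 - xq) = 0" using l(3)[of x3] P(3) by (simp add: on_curve_def)
    then show False using ne q by auto
  qed
  have "(b - b') * (x1 - x2) = ((b - b') * x1 + (c - c')) - ((b - b') * x2 + (c - c'))"
    by (simp add: algebra_simps)
  also have "\<dots> = 0" using lin(1,2) by (simp only: aa diff_self mult_zero_left add_0)
  finally have "(b - b') * (x1 - x2) = 0" .
  then have bb: "b = b'" using ne(1) by simp
  then have cc: "c = c'" using lin(1) aa by simp
  have xx: "xT = xS" using abc(5) abc'(5) aa bb by simp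
  \<comment> \<open>For a = 0 the quadratic x^2 + b x + c would have three distinct roots. A nonzero
    a is what determines yT from xT.\<close>
  have a0: "a \<noteq> 0"
  proof
    assume "a = 0"
    then have 1: "x1^2 + b * x1 + c = 0" "x2^2 + b * x2 + c = 0" "x3^2 + b * x3 + c = 0"
      using abc(1-3) by simp_all
    have "(x1 - x2) * (x1 + x2 + b) = (x1^2 + b * x1 + c) - (x2^2 + b * x2 + c)"
      "(x1 - x3) * (x1 + x3 + b) = (x1^2 + b * x1 + c) - (x3^2 + b * x3 + c)"
      by Groebner_Basis.algebra+
    then have "x1 + x2 + b = 0" "x1 + x3 + b = 0" using 1 ne by simp_all
    then have "x2 = x3" by (metis add_left_cancel add_right_cancel)
    then show False using ne by simp
  qed
  have "a * yT = a * yS" using abc(4) abc'(4) aa bb cc xx by simp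
  then have "(xT, yT) = (xS, yS)" using a0 xx by simp
  then show ?thesis using T S chord_commute[of "(x1, y1)" "chord (x2, y2) (x3, y3)"] ne by auto
qed

section \<open>Transfer from the complex numbers to residue rings\<close>

text \<open>\<open>\<rho> g s\<close> says that some formal expression takes the complex values g
  under the choices of signs and the value s modulo M. It is a relation because g may come from
  several expressions; applied to differences, \<open>sound\<close> shows that their residues
  agree.\<close>

locale transfer_rel =
  fixes M :: int and \<rho> :: "('i \<Rightarrow> complex) \<Rightarrow> int \<Rightarrow> bool"
  assumes const: "\<rho> (\<lambda>_. of_int n) n"
    and add: "\<rho> g s \<Longrightarrow> \<rho> h t \<Longrightarrow> \<rho> (\<lambda>i. g i + h i) (s + t)"
    and mult: "\<rho> g s \<Longrightarrow> \<rho> h t \<Longrightarrow> \<rho> (\<lambda>i. g i * h i) (s * t)"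
    and sound: "\<rho> (\<lambda>_. 0) s \<Longrightarrow> M dvd s"
begin

lemma numeral: "\<rho> (\<lambda>_. numeral k) (numeral k)"
  using const[of "numeral k"] by simp

lemma uminus: "\<rho> g s \<Longrightarrow> \<rho> (\<lambda>i. - g i) (- s)"
  using mult[OF const[of "-1"], of g s] by simp

lemma diff: "\<rho> g s \<Longrightarrow> \<rho> h t \<Longrightarrow> \<rho> (\<lambda>i. g i - h i) (s - t)"
  using add[OF _ uminus, of g s h t] by simp

lemma power: "\<rho> g s \<Longrightarrow> \<rho> (\<lambda>i. g i ^ k) (s ^ k)"
proof (induction k)
  case 0 then show ?case using const[of 1] by simp
next
  case (Suc k) then show ?case using mult[of g s] by simp
qed

lemmas intros = numeral diff uminus add mult power const

definition rel3 :: "('i \<Rightarrow> complex \<times> complex \<times> complex) \<Rightarrow> int \<times> int \<times> int \<Rightarrow> bool"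
  where "rel3 P s \<longleftrightarrow> \<rho> (\<lambda>i. fst (P i)) (fst s) \<and> \<rho> (\<lambda>i. fst (snd (P i))) (fst (snd s))
    \<and> \<rho> (\<lambda>i. snd (snd (P i))) (snd (snd s))"

lemma rel3_law:
  assumes "rel3 P s" "rel3 Q t"
  shows "rel3 (\<lambda>i. law k (of_int A) (of_int B) (P i) (Q i)) (law k A B s t)"
proof -
  note r = assms[unfolded rel3_def]
  consider "k = 0" | "k = 1" | "k > 1" by linarith
  then show ?thesis
    by cases (simp_all add: rel3_def law_defs case_prod_beta; insert r; intro conjI intros; simp)+
qed

lemma rel3_cross:
  assumes "rel3 P s" "rel3 Q t" 
  shows "rel3 (\<lambda>i. cross (P i) (Q i)) (cross s t)"
  using assms by (simp add: rel3_def cross_def case_prod_beta intros)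

lemma rel_cubic:
  assumes "rel3 P s"
  shows "\<rho> (\<lambda>i. cubic (of_int A) (of_int B) (P i)) (cubic A B s)"
  using assms unfolding cubic_def rel3_def case_prod_beta by (intro intros) auto

end

text \<open>
  A formal square root is represented by the function that maps a choice of signs to a complex
  number. Adjoining one more square root \<open>w\<close> adds one sign to the index type, and \<open>t\<close> is its value
  modulo \<open>M\<close>. Soundness survives because \<open>g\<^sub>0 + w g\<^sub>1\<close> and \<open>g\<^sub>0 - w g\<^sub>1\<close> vanish together only if
  both \<open>g\<^sub>0\<close> and \<open>g\<^sub>1\<close> do.
\<close>

definition adjoin :: "int \<Rightarrow> complex \<Rightarrow> int \<Rightarrow> (('i \<Rightarrow> complex) \<Rightarrow> int \<Rightarrow> bool)
    \<Rightarrow> ('i \<times> bool \<Rightarrow> complex) \<Rightarrow> int \<Rightarrow> bool"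
  where "adjoin M w t \<rho> g s \<longleftrightarrow> (\<exists>g0 s0 g1 s1. \<rho> g0 s0 \<and> \<rho> g1 s1 \<and>
    g = (\<lambda>(i, b). g0 i + (if b then w else - w) * g1 i) \<and> [s = s0 + t * s1] (mod M))"

lemma transfer_rel_adjoin:
  assumes "transfer_rel M \<rho>" and w: "w^2 = of_int d" and d: "d \<noteq> 0" and t: "[t^2 = d] (mod M)"
  shows "transfer_rel M (adjoin M w t \<rho>)"
proof -
  interpret transfer_rel M \<rho> by fact
  show ?thesis
  proof
    fix n show "adjoin M w t \<rho> (\<lambda>_. of_int n) n"
      unfolding adjoin_def
      by (rule exI[of _ "\<lambda>_. of_int n"], rule exI[of _ n], rule exI[of _ "\<lambda>_. 0"], rule exI[of _ 0])
        (use const[of n] const[of 0] in auto)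
  next
    fix g h a b assume "adjoin M w t \<rho> g a" "adjoin M w t \<rho> h b"
    then obtain g0 a0 g1 a1 h0 b0 h1 b1 where
      g: "\<rho> g0 a0" "\<rho> g1 a1" "g = (\<lambda>(i, b). g0 i + (if b then w else - w) * g1 i)" "[a = a0 + t * a1] (mod M)" and
      h: "\<rho> h0 b0" "\<rho> h1 b1" "h = (\<lambda>(i, b). h0 i + (if b then w else - w) * h1 i)" "[b = b0 + t * b1] (mod M)"
      unfolding adjoin_def by blast
    show "adjoin M w t \<rho> (\<lambda>i. g i + h i) (a + b)"
      unfolding adjoin_def
    proof (intro exI conjI)
      show "\<rho> (\<lambda>i. g0 i + h0 i) (a0 + b0)" "\<rho> (\<lambda>i. g1 i + h1 i) (a1 + b1)"
        using g h add by blast+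
      show "(\<lambda>i. g i + h i) = (\<lambda>(i, b). g0 i + h0 i + (if b then w else - w) * (g1 i + h1 i))"
        by (auto simp: g h algebra_simps)
      show "[a + b = a0 + b0 + t * (a1 + b1)] (mod M)"
        using cong_add[OF g(4) h(4)] by (simp add: algebra_simps)
    qed
    show "adjoin M w t \<rho> (\<lambda>i. g i * h i) (a * b)"
      unfolding adjoin_def
    proof (intro exI conjI)
      show "\<rho> (\<lambda>i. g0 i * h0 i + of_int d * (g1 i * h1 i)) (a0 * b0 + d * (a1 * b1))"
        by (intro intros g h)
      show "\<rho> (\<lambda>i. g0 i * h1 i + g1 i * h0 i) (a0 * b1 + a1 * b0)"
        by (intro intros g h)
      show "(\<lambda>i. g i * h i) = (\<lambda>(i, b). g0 i * h0 i + of_int d * (g1 i * h1 i) +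
          (if b then w else - w) * (g0 i * h1 i + g1 i * h0 i))"
        by (auto simp: g h algebra_simps power2_eq_square simp flip: w)
      have "[a * b = (a0 + t * a1) * (b0 + t * b1)] (mod M)" by (intro cong_mult g h)
      also have "(a0 + t * a1) * (b0 + t * b1) =
          a0 * b0 + t^2 * (a1 * b1) + t * (a0 * b1 + a1 * b0)"
        by (simp add: algebra_simps power2_eq_square)
      also have "[\<dots> = a0 * b0 + d * (a1 * b1) + t * (a0 * b1 + a1 * b0)] (mod M)"
        by (intro cong_add cong_mult t cong_refl)
      finally show "[a * b = a0 * b0 + d * (a1 * b1) + t * (a0 * b1 + a1 * b0)] (mod M)" .
    qed
  next
    fix a assume "adjoin M w t \<rho> (\<lambda>_. 0) a"
    then obtain g0 a0 g1 a1 where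
      g: "\<rho> g0 a0" "\<rho> g1 a1" "(\<lambda>_. 0) = (\<lambda>(i, b). g0 i + (if b then w else - w) * g1 i)"
      and a: "[a = a0 + t * a1] (mod M)"
      unfolding adjoin_def by blast
    have "g0 i = 0 \<and> g1 i = 0" for i
    proof -
      have 1: "g0 i + w * g1 i = 0" using fun_cong[OF g(3), of "(i, True)"] by simp
      have 2: "g0 i - w * g1 i = 0" using fun_cong[OF g(3), of "(i, False)"] by simp
      have "2 * g0 i = (g0 i + w * g1 i) + (g0 i - w * g1 i)"
        "2 * (w * g1 i) = (g0 i + w * g1 i) - (g0 i - w * g1 i)" by simp_all
      then have "2 * g0 i = 0" "2 * (w * g1 i) = 0" unfolding 1 2 by simp_all
      moreover have "w \<noteq> 0" using w d by auto
      ultimately show ?thesis by simp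
    qed
    then have "\<rho> (\<lambda>_. 0) a0" "\<rho> (\<lambda>_. 0) a1" using g(1,2) by (metis ext)+
    then have "M dvd a0" "M dvd a1" by (auto intro: sound)
    then have "M dvd a0 + t * a1" by simp
    then show "M dvd a" using a by (simp add: cong_dvd_iff)
  qed
qed

lemma adjoin_generator:
  assumes "transfer_rel M \<rho>"
  shows "adjoin M w t \<rho> (\<lambda>(i, b). if b then w else - w) t"
  unfolding adjoin_def
proof (intro exI conjI)
  interpret transfer_rel M \<rho> by fact
  show "\<rho> (\<lambda>_. 0) 0" "\<rho> (\<lambda>_. 1) 1" using const[of 0] const[of 1] by simp_all
qed auto

lemma adjoin_base:
  assumes "transfer_rel M \<rho>" "\<rho> g s"
  shows "adjoin M w t \<rho> (\<lambda>i. g (fst i)) s"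
proof -
  interpret transfer_rel M \<rho> by fact
  show ?thesis
    unfolding adjoin_def
    by (rule exI[of _ g], rule exI[of _ s], rule exI[of _ "\<lambda>_. 0"], rule exI[of _ 0])
      (use assms(2) const[of 0] in auto)
qed

lemma transfer_rel_const: "transfer_rel M (\<lambda>g s. g = (\<lambda>_ :: unit. of_int s))"
  by unfold_locales (auto simp: fun_eq_iff)

lemma transfer_rel_three_square_roots:
  assumes "[t1^2 = d1] (mod M)" "d1 \<noteq> 0" "[t2^2 = d2] (mod M)" "d2 \<noteq> 0" "[t3^2 = d3] (mod M)" "d3 \<noteq> 0"
  obtains \<rho> :: "(((unit \<times> bool) \<times> bool) \<times> bool \<Rightarrow> complex) \<Rightarrow> int \<Rightarrow> bool" and r1 r2 r3 where
    "transfer_rel M \<rho>" "\<rho> r1 t1" "\<rho> r2 t2" "\<rho> r3 t3"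
    "\<And>i. r1 i^2 = of_int d1" "\<And>i. r2 i^2 = of_int d2" "\<And>i. r3 i^2 = of_int d3"
proof -
  define w where "w d = csqrt (of_int d)" for d
  have w: "(w d)^2 = of_int d" for d by (simp add: w_def)
  let ?\<rho>0 = "\<lambda>g s. g = (\<lambda>_ :: unit. of_int s)"
  let ?\<rho>1 = "adjoin M (w d1) t1 ?\<rho>0" let ?\<rho>2 = "adjoin M (w d2) t2 ?\<rho>1"
  note t0 = transfer_rel_const[of M]
  note t1 = transfer_rel_adjoin[OF t0 w assms(2,1)]
  note t2 = transfer_rel_adjoin[OF t1 w assms(4,3)]
  show thesis
  proof (rule that)
    show "transfer_rel M (adjoin M (w d3) t3 ?\<rho>2)"
      by (rule transfer_rel_adjoin[OF t2 w assms(6,5)])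
    show "adjoin M (w d3) t3 ?\<rho>2 (\<lambda>i. (\<lambda>i. (\<lambda>(i, b). if b then w d1 else - w d1) (fst i)) (fst i)) t1"
      by (intro adjoin_base adjoin_generator t0 t1 t2)
    show "adjoin M (w d3) t3 ?\<rho>2 (\<lambda>i. (\<lambda>(i, b). if b then w d2 else - w d2) (fst i)) t2"
      by (intro adjoin_base adjoin_generator t0 t1 t2)
    show "adjoin M (w d3) t3 ?\<rho>2 (\<lambda>(i, b). if b then w d3 else - w d3) t3"
      by (intro adjoin_base adjoin_generator t0 t1 t2)
  qed (auto simp: w split: prod.splits)
qed

section \<open>Points modulo a prime power\<close>

text \<open>If P2 + P3 has the x-coordinate of P1, then P3 is P1 - P2 or - P1 - P2, so x3 is one of
  two values that depend on P1 and P2 only. Hence a condition on the other bracketing can be met by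
  a choice of x3 after the first two points are fixed.\<close>

lemma fst_chord_swap:
  fixes A B :: "'a::field"
  assumes "on_curve A B (x1, y1)" "on_curve A B (x2, y2)" "on_curve A B (x3, y3)"
    and "x2 \<noteq> x3" "x1 \<noteq> x2" and "fst (chord (x2, y2) (x3, y3)) = x1"
  shows "x3 = fst (chord (x1, y1) (x2, y2)) \<or> x3 = fst (chord (x1, - y1) (x2, y2))"
proof -
  obtain y' where y': "chord (x2, y2) (x3, y3) = (x1, y')" using assms(6) by (metis prod.collapse)
  then have "on_curve A B (x1, y')" using chord_on_curve[of A B "(x2, y2)" "(x3, y3)"] assms by simp
  then have "y'^2 = y1^2" using assms(1) by (simp add: on_curve_def)
  then have y1: "- y' = y1 \<or> - y' = - y1" by (auto simp: power2_eq_iff)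
  obtain l m where l: "y2 = l * x2 + m" "- y' = l * x1 + m" "x1 = l^2 - x2 - x3"
    using chord_line[OF assms(2,3,4) y'] by metis
  have "(y2 - (- y')) / (x2 - x1) = l"
    using assms(5) unfolding l(1,2) by (simp add: field_simps)
  then have "fst (chord (x1, - y') (x2, y2)) = l^2 - x1 - x2" by (simp add: Let_def)
  also have "\<dots> = x3" using l(3) by (simp add: algebra_simps)
  finally show ?thesis using y1 by metis
qed

definition cong3 :: "int \<Rightarrow> int \<times> int \<times> int \<Rightarrow> int \<times> int \<times> int \<Rightarrow> bool"
  where "cong3 M = (\<lambda>(x, y, z) (x', y', z'). [x = x'] (mod M) \<and> [y = y'] (mod M) \<and> [z = z'] (mod M))"

lemma cong3_refl [simp]: "cong3 M s s" by (cases s) (simp add: cong3_def)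
lemma cong3_sym: "cong3 M s t \<Longrightarrow> cong3 M t s" by (cases s; cases t) (simp add: cong3_def cong_sym)
lemma cong3_trans: "cong3 M s t \<Longrightarrow> cong3 M t w \<Longrightarrow> cong3 M s w"
  by (cases s; cases t; cases w) (auto simp: cong3_def intro: cong_trans)

lemma cong3_smul: "cong3 M s t \<Longrightarrow> [u = v] (mod M) \<Longrightarrow> cong3 M (smul u s) (smul v t)"
  by (cases s; cases t) (auto simp: cong3_def smul_def intro: cong_mult)

lemma cong3_cross: "cong3 M s s' \<Longrightarrow> cong3 M t t' \<Longrightarrow> cong3 M (cross s t) (cross s' t')"
  by (cases s; cases t; cases s'; cases t') (auto simp: cong3_def cross_def intro!: cong_mult cong_diff)

lemma cong_cubic: "cong3 M s t \<Longrightarrow> [cubic A B s = cubic A B t] (mod M)"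
  by (cases s; cases t) (auto simp: cong3_def cubic_def intro!: cong_mult cong_diff cong_add cong_pow)

lemma cong_uminus: "[a = b] (mod M) \<Longrightarrow> [- a = - b] (mod M)" for a b M :: int
  by (simp add: cong_minus_minus_iff)

lemma cong3_law:
  assumes "cong3 M s s'" "cong3 M t t'"
  shows "cong3 M (law i A B s t) (law i A B s' t')"
proof -
  obtain x y z x' y' z' where s: "s = (x, y, z)" "s' = (x', y', z')" by (cases s; cases s')
  obtain a b c a' b' c' where t: "t = (a, b, c)" "t' = (a', b', c')" by (cases t; cases t')
  note r = assms[unfolded s t cong3_def prod.case]
  consider "i = 0" | "i = 1" | "i > 1" by linarith
  then show ?thesis
    by cases (simp_all add: cong3_def law_defs s t; insert r;
      intro conjI cong_diff cong_uminus cong_add cong_mult cong_pow cong_refl; simp)+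
qed

lemma cross_smul: "cross (smul u s) (smul v t) = smul (u * v) (cross s t)"
proof -
  obtain x y z x' y' z' where s: "s = (x, y, z)" "t = (x', y', z')" by (cases s; cases t)
  show ?thesis unfolding s by (simp add: cross_def smul_def algebra_simps)
qed

lemma smul_smul: "smul u (smul v s) = smul (u * v) s"
  by (cases s) (simp add: smul_def mult.assoc)

lemma smul_one [simp]: "smul 1 s = s"
  by (cases s) (simp add: smul_def)

lemma cross_self_zero [simp]: "cross s s = (0, 0, 0)"
  by (cases s) (simp add: cross_def mult.commute)

lemma smul_zero [simp]: "smul u (0, 0, 0) = (0, 0, 0)"
  by (simp add: smul_def)

lemma cong3_smul_zero_cancel:
  "cong3 M (smul u s) (0, 0, 0) \<Longrightarrow> coprime u M \<Longrightarrow> cong3 M s (0, 0, 0)"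
  by (cases s) (auto simp: cong3_def smul_def cong_0_iff coprime_commute coprime_dvd_mult_right_iff)

locale weierstrass_mod =
  fixes p :: int and e :: nat and A B :: int
  assumes prime: "prime p" and e: "e \<ge> 1"
begin

abbreviation M :: int where "M \<equiv> p ^ e"

text \<open>The ring Z/p^e is local with maximal ideal generated by p, so a triple generates the
  unit ideal exactly if some coordinate is prime to p. Points are handled as integer triples up to
  congruence.\<close>

definition prim :: "int \<times> int \<times> int \<Rightarrow> bool"
  where "prim = (\<lambda>(x, y, z). \<not> (p dvd x \<and> p dvd y \<and> p dvd z))"

definition pt :: "int \<times> int \<times> int \<Rightarrow> bool"
  where "pt s \<longleftrightarrow> prim s \<and> M dvd cubic A B s"

lemma p_dvd_M: "p dvd M" using e by (simp add: dvd_power)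

lemma M_pos: "M > 1" using prime e by (metis less_le_trans one_less_power prime_gt_1_int zero_less_one less_one linorder_not_less)

lemma coprime_M: "coprime u M \<longleftrightarrow> \<not> p dvd u"
  using prime e by (metis coprime_commute coprime_power_right_iff not_one_le_zero prime_imp_coprime
      coprime_common_divisor dvd_refl not_prime_unit linorder_not_less less_one not_gr_zero)

lemma inverse_mod:
  assumes "\<not> p dvd u"
  obtains v where "[u * v = 1] (mod M)" "\<not> p dvd v"
proof -
  obtain v where v: "[u * v = 1] (mod M)"
    using assms coprime_M cong_solve_coprime_int by blast
  moreover have "\<not> p dvd v"
  proof
    assume "p dvd v"
    then have "p dvd 1" using v p_dvd_M by (metis cong_dvd_iff cong_dvd_modulus dvd_mult)
    then show False using prime by (simp add: not_prime_unit)
  qed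
  ultimately show thesis by (rule that)
qed

text \<open>
  An affine point has the chart \<open>s = 1\<close>. At the point at infinity \<open>(X : 1 : Z)\<close> take \<open>s = X\<close> and
  \<open>a = t = v\<close> with \<open>v = 1 - A X Z - B Z\<^sup>2\<close>, as the curve equation says \<open>X\<^sup>3 = v Z\<close>.
\<close>

lemma pt_chart:
  assumes "pt P"
  obtains a s t u where "s \<noteq> 0" "\<not> p dvd u" "cong3 M (a * s, t, s^3) (smul u P)"
    "[t^2 = a^3 + A * a * s^4 + B * s^6] (mod M)"
proof -
  obtain x y z where P: "P = (x, y, z)" by (cases P)
  have pr: "\<not> (p dvd x \<and> p dvd y \<and> p dvd z)"
    and eq: "[y^2 * z = x^3 + A * x * z^2 + B * z^3] (mod M)"
    using assms by (auto simp: pt_def prim_def P cubic_def cong_iff_dvd_diff)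
  show thesis
  proof (cases "p dvd z")
    case False
    then obtain u where u: "[z * u = 1] (mod M)" "\<not> p dvd u" by (rule inverse_mod)
    have "[u^3 * (y^2 * z) = u^3 * (x^3 + A * x * z^2 + B * z^3)] (mod M)"
      using eq by (rule cong_mult[OF cong_refl])
    moreover have "u^3 * (y^2 * z) = (u * y)^2 * (z * u)" by (simp add: power2_eq_square power3_eq_cube)
    moreover have "u^3 * (x^3 + A * x * z^2 + B * z^3) =
        (u * x)^3 + A * (u * x) * (z * u)^2 + B * (z * u)^3"
      by (simp add: power2_eq_square power3_eq_cube algebra_simps)
    ultimately have 1: "[(u * y)^2 * (z * u) =
        (u * x)^3 + A * (u * x) * (z * u)^2 + B * (z * u)^3] (mod M)" by simp
    have 2: "[(u * y)^2 * (z * u) = (u * y)^2 * 1] (mod M)"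
      "[(u * x)^3 + A * (u * x) * (z * u)^2 + B * (z * u)^3 =
        (u * x)^3 + A * (u * x) * 1^2 + B * 1^3] (mod M)"
      by (intro cong_add cong_mult cong_pow cong_refl u)+
    have "[(u * y)^2 = (u * x)^3 + A * (u * x) * 1^4 + B * 1^6] (mod M)"
      using cong_trans[OF cong_trans[OF cong_sym[OF 2(1)] 1] 2(2)] by simp
    moreover have "cong3 M (u * x * 1, u * y, 1^3) (smul u P)"
      using u by (simp add: P smul_def cong3_def cong_sym mult.commute)
    ultimately show thesis using that[of 1 u "u * x" "u * y"] u by simp
  next
    case True
    have "p dvd x^3"
    proof -
      have "p dvd y^2 * z - (x^3 + A * x * z^2 + B * z^3)"
        using eq p_dvd_M dvd_trans by (auto simp: cong_iff_dvd_diff)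
      moreover have "p dvd y^2 * z - (A * x * z^2 + B * z^3)"
        using True by (intro dvd_diff dvd_add dvd_mult) (auto simp: power2_eq_square power3_eq_cube)
      ultimately have "p dvd y^2 * z - (A * x * z^2 + B * z^3) - (y^2 * z - (x^3 + A * x * z^2 + B * z^3))"
        using dvd_diff by blast
      then show ?thesis by (simp add: algebra_simps)
    qed
    then have x: "p dvd x" using prime prime_dvd_power by blast
    then have "\<not> p dvd y" using True pr by simp
    then obtain u where u: "[y * u = 1] (mod M)" "\<not> p dvd u" by (rule inverse_mod)
    \<comment> \<open>Over the complex numbers the chart divides by s, so s must be a nonzero
      integer; M replaces 0 without changing the residue.\<close>
    define X where "X = (if u * x = 0 then M else u * x)"
    define Z where "Z = u * z"
    define v where "v = 1 - A * X * Z - B * Z^2"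
    have X: "X \<noteq> 0" "[X = u * x] (mod M)" "p dvd X"
      using prime x p_dvd_M by (auto simp: X_def cong_def)
    have Z: "p dvd Z" using True by (simp add: Z_def)
    have v: "\<not> p dvd v"
    proof
      assume "p dvd v"
      then have "p dvd v + A * X * Z + B * Z^2" using Z by (simp add: power2_eq_square)
      then show False using prime by (simp add: v_def not_prime_unit)
    qed
    have "[u^3 * (y^2 * z) = u^3 * (x^3 + A * x * z^2 + B * z^3)] (mod M)"
      using eq by (rule cong_mult[OF cong_refl])
    moreover have "u^3 * (y^2 * z) = (y * u)^2 * Z" by (simp add: Z_def power2_eq_square power3_eq_cube)
    moreover have "u^3 * (x^3 + A * x * z^2 + B * z^3) =
        (u * x)^3 + A * (u * x) * Z^2 + B * Z^3"
      by (simp add: Z_def power2_eq_square power3_eq_cube algebra_simps)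
    ultimately have 1: "[(y * u)^2 * Z = (u * x)^3 + A * (u * x) * Z^2 + B * Z^3] (mod M)" by simp
    have 2: "[(y * u)^2 * Z = 1^2 * Z] (mod M)"
      "[(u * x)^3 + A * (u * x) * Z^2 + B * Z^3 = X^3 + A * X * Z^2 + B * Z^3] (mod M)"
      by (intro cong_add cong_mult cong_pow cong_refl u cong_sym[OF X(2)])+
    have "[Z = X^3 + A * X * Z^2 + B * Z^3] (mod M)"
      using cong_trans[OF cong_trans[OF cong_sym[OF 2(1)] 1] 2(2)] by simp
    then have "[Z - (A * X * Z^2 + B * Z^3) = X^3 + A * X * Z^2 + B * Z^3 - (A * X * Z^2 + B * Z^3)] (mod M)"
      by (intro cong_diff cong_refl)
    moreover have "Z - (A * X * Z^2 + B * Z^3) = v * Z"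
      by (simp add: v_def algebra_simps power2_eq_square power3_eq_cube)
    ultimately have vZ: "[X^3 = v * Z] (mod M)" by (simp add: cong_sym)
    \<comment> \<open>After replacing X^3 by v Z the right-hand side is v^2 (v + A X Z + B Z^2), and
      the bracket is 1 by the choice of v.\<close>
    have 3: "[v^3 + A * v * X * X^3 + B * X^3 * X^3 = v^3 + A * v * X * (v * Z) + B * (v * Z) * (v * Z)] (mod M)"
      by (intro cong_add cong_mult cong_refl vZ)
    have 4: "v^3 + A * v * X * (v * Z) + B * (v * Z) * (v * Z) = v^2"
    proof -
      have "v^3 + A * v * X * (v * Z) + B * (v * Z) * (v * Z) = v^2 * (v + A * X * Z + B * Z^2)"
        by (simp add: algebra_simps power2_eq_square power3_eq_cube)
      also have "v + A * X * Z + B * Z^2 = 1" by (simp add: v_def)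
      finally show ?thesis by simp
    qed
    have 5: "v^3 + A * v * X * X^3 + B * X^3 * X^3 = v^3 + A * v * X^4 + B * X^6"
      by (simp add: eval_nat_numeral)
    have "[v^2 = v^3 + A * v * X^4 + B * X^6] (mod M)" using 3 unfolding 4 5 by (rule cong_sym)
    moreover have "cong3 M (v * X, v, X^3) (smul (v * u) P)"
    proof -
      have "[v * X = v * (u * x)] (mod M)" "[v * 1 = v * (y * u)] (mod M)"
        by (intro cong_mult cong_refl X cong_sym[OF u(1)])+
      then show ?thesis using vZ by (simp add: P smul_def cong3_def Z_def ac_simps)
    qed
    moreover have "\<not> p dvd v * u" using v u(2) prime prime_dvd_mult_iff by blast
    ultimately show thesis using that[of X "v * u" v v] X(1) by simp
  qed
qed

lemma pt_generic_chart:
  assumes "pt P" and "finite S"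
  obtains a s t u where "s \<noteq> 0" "\<not> p dvd u" "cong3 M (a * s, t, s^3) (smul u P)"
    "[t^2 = a^3 + A * a * s^4 + B * s^6] (mod M)"
    "(of_int a / of_int s^2 :: complex) \<notin> S" "a^3 + A * a * s^4 + B * s^6 \<noteq> 0"
proof -
  obtain a s t u where ast: "s \<noteq> 0" "\<not> p dvd u" "cong3 M (a * s, t, s^3) (smul u P)"
    "[t^2 = a^3 + A * a * s^4 + B * s^6] (mod M)"
    using pt_chart[OF assms(1)] by metis
  \<comment> \<open>At these roots the integer under the square root is zero, which the adjunction
    of a square root does not allow.\<close>
  define T where "T = {x :: complex. poly [:of_int B, of_int A, 0, 1:] x = 0}"
  have T: "finite T" unfolding T_def by (rule poly_roots_finite) simp
  define f where "f k = (of_int (a + M * k) / of_int s^2 :: complex)" for k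
  have "inj f"
  proof (rule injI)
    fix k k' assume "f k = f k'"
    then have "(of_int (a + M * k) :: complex) = of_int (a + M * k')"
      using ast(1) by (simp add: f_def)
    then have "M * k = M * k'" by (simp only: of_int_eq_iff)
    then show "k = k'" using M_pos prime by auto
  qed
  then have "infinite (range f)" by (simp add: finite_image_iff infinite_UNIV_int)
  then have "\<not> range f \<subseteq> S \<union> T" using assms(2) T finite_subset by blast
  then obtain k where k: "f k \<notin> S" "f k \<notin> T" by blast
  define a' where "a' = a + M * k"
  have aa: "[a' = a] (mod M)" by (simp add: a'_def cong_def)
  show thesis
  proof (rule that[OF ast(1,2), of a' t])
    have "cong3 M (a' * s, t, s^3) (a * s, t, s^3)"
      by (simp add: cong3_def cong_mult aa)
    then show "cong3 M (a' * s, t, s^3) (smul u P)" using ast(3) cong3_trans by blast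
    have "[a'^3 + A * a' * s^4 + B * s^6 = a^3 + A * a * s^4 + B * s^6] (mod M)"
      by (intro cong_add cong_mult cong_pow cong_refl aa)
    then show "[t^2 = a'^3 + A * a' * s^4 + B * s^6] (mod M)" using ast(4) cong_trans cong_sym by blast
    show "of_int a' / of_int s^2 \<notin> S" using k(1) by (simp add: f_def a'_def)
    show "a'^3 + A * a' * s^4 + B * s^6 \<noteq> 0"
    proof
      assume "a'^3 + A * a' * s^4 + B * s^6 = 0"
      then have 0: "(of_int a'^3 + of_int A * of_int a' * of_int s^4 + of_int B * of_int s^6 :: complex) = 0"
        by (metis of_int_0 of_int_add of_int_mult of_int_power)
      have "of_int B + f k * (of_int A + f k * f k) =
          (of_int a'^3 + of_int A * of_int a' * of_int s^4 + of_int B * of_int s^6 :: complex) / of_int s^6"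
        using ast(1) by (simp add: f_def a'_def field_simps eval_nat_numeral)
      then have "f k \<in> T" using 0 by (simp add: T_def)
      then show False using k(2) by simp
    qed
  qed
qed

end

definition aff :: "'a::comm_ring_1 \<times> 'a \<Rightarrow> 'a \<times> 'a \<times> 'a"
  where "aff P = (fst P, snd P, 1)"

lemma law_smul_aff:
  fixes A B :: "'a::field"
  assumes "on_curve A B P" "on_curve A B Q" "fst P \<noteq> fst Q"
  obtains k where "law i A B (smul u (aff P)) (smul v (aff Q)) = smul k (aff (chord P Q))"
proof -
  obtain k where "law i A B (aff P) (aff Q) = smul k (aff (chord P Q))"
    using law_chord[of A B "fst P" "snd P" "fst Q" "snd Q" i] assms by (auto simp: aff_def)
  then show thesis using that by (simp add: law_smul smul_smul)
qed

lemma cubic_smul_aff: "on_curve (A :: 'a::idom) B P \<Longrightarrow> cubic A B (smul k (aff P)) = 0"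
  unfolding cubic_smul by (simp add: cubic_def aff_def on_curve_def case_prod_beta)

lemma chart_smul_aff:
  fixes r :: complex
  assumes "s \<noteq> 0" "r^2 = of_int (a^3 + A * a * s^4 + B * s^6)"
  shows "(of_int (a * s), r, of_int (s^3)) = smul (of_int s^3) (aff (of_int a / of_int s^2, r / of_int s^3))"
    and "on_curve (of_int A) (of_int B) (of_int a / of_int s^2, r / of_int s^3)"
proof -
  show "(of_int (a * s), r, of_int (s^3)) = smul (of_int s^3) (aff (of_int a / of_int s^2, r / of_int s^3))"
    using assms(1) by (simp add: smul_def aff_def field_simps power2_eq_square power3_eq_cube)
  have "(r / of_int s^3)^2 = of_int (a^3 + A * a * s^4 + B * s^6) / of_int s^6"
    by (simp add: power_divide assms(2) flip: power_mult)
  also have "\<dots> = (of_int a / of_int s^2)^3 + of_int A * (of_int a / of_int s^2) + of_int B"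
    using assms(1) by (simp add: field_simps eval_nat_numeral)
  finally show "on_curve (of_int A) (of_int B) (of_int a / of_int s^2, r / of_int s^3)"
    by (simp add: on_curve_def)
qed

context transfer_rel
begin

lemma rel3_sound: "rel3 P s \<Longrightarrow> (\<And>i. P i = (0, 0, 0)) \<Longrightarrow> cong3 M s (0, 0, 0)"
  by (cases s) (auto simp: rel3_def cong3_def cong_0_iff intro: sound)

lemma rel3_chart: "\<rho> r t \<Longrightarrow> rel3 (\<lambda>i. (of_int a, r i, of_int b)) (a, t, b)"
  using const[of a] const[of b] by (simp add: rel3_def)

end

section \<open>Polynomial identities for the addition laws modulo p^e\<close>

context weierstrass_mod
begin

text \<open>Multiplied by units, the three points become charts whose second coordinates are formal
  square roots. For every choice of signs the complex law values are multiples of the expected chord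
  points, so the minors and the cubic vanish identically. The three claims share one generic choice
  of charts.\<close>

lemma
  assumes "pt P" "pt Q" "pt W"
  shows law_minors: "cong3 M (cross (law i A B P Q) (law j A B P Q)) (0, 0, 0)"
    and law_cubic: "M dvd cubic A B (law i A B P Q)"
    and law_assoc: "cong3 M (cross (law i A B (law j A B P Q) W) (law k A B P (law l A B Q W))) (0, 0, 0)"
proof -
  define AC where "AC = (of_int A :: complex)"
  define BC where "BC = (of_int B :: complex)"
  obtain a1 s1 t1 u1 where 1: "s1 \<noteq> 0" "\<not> p dvd u1" "cong3 M (a1 * s1, t1, s1^3) (smul u1 P)"
    "[t1^2 = a1^3 + A * a1 * s1^4 + B * s1^6] (mod M)" "a1^3 + A * a1 * s1^4 + B * s1^6 \<noteq> 0"
    using pt_generic_chart[OF assms(1) finite.emptyI] by metis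
  define x1 :: complex where "x1 = of_int a1 / of_int s1^2"
  obtain a2 s2 t2 u2 where 2: "s2 \<noteq> 0" "\<not> p dvd u2" "cong3 M (a2 * s2, t2, s2^3) (smul u2 Q)"
    "[t2^2 = a2^3 + A * a2 * s2^4 + B * s2^6] (mod M)" "a2^3 + A * a2 * s2^4 + B * s2^6 \<noteq> 0"
    and x21: "of_int a2 / of_int s2^2 \<notin> {x1}"
    using pt_generic_chart[OF assms(2), of "{x1}"] by (metis finite.simps)
  define x2 :: complex where "x2 = of_int a2 / of_int s2^2"
  define Y where "Y x = {y. y^2 = x^3 + AC * x + BC}" for x
  have Y: "finite (Y x)" for x unfolding Y_def by (rule finite_nth_roots) simp
  \<comment> \<open>One x3 has to work for all signs of the square roots simultaneously, so S
    contains the x-coordinates of the sums for every pair of y-values over x1 and x2.\<close>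
  define S where "S = {x1, x2} \<union> (\<lambda>(y1, y2). fst (chord (x1, y1) (x2, y2))) ` (Y x1 \<times> Y x2)"
  have S: "finite S" unfolding S_def using Y by simp
  obtain a3 s3 t3 u3 where 3: "s3 \<noteq> 0" "\<not> p dvd u3" "cong3 M (a3 * s3, t3, s3^3) (smul u3 W)"
    "[t3^2 = a3^3 + A * a3 * s3^4 + B * s3^6] (mod M)" "a3^3 + A * a3 * s3^4 + B * s3^6 \<noteq> 0"
    and x3S: "of_int a3 / of_int s3^2 \<notin> S"
    using pt_generic_chart[OF assms(3) S] by metis
  define x3 :: complex where "x3 = of_int a3 / of_int s3^2"
  obtain \<rho> :: "(((unit \<times> bool) \<times> bool) \<times> bool \<Rightarrow> complex) \<Rightarrow> int \<Rightarrow> bool" and r1 r2 r3 where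
    \<rho>: "transfer_rel M \<rho>" "\<rho> r1 t1" "\<rho> r2 t2" "\<rho> r3 t3"
    and r1: "\<And>i. r1 i^2 = of_int (a1^3 + A * a1 * s1^4 + B * s1^6)"
    and r2: "\<And>i. r2 i^2 = of_int (a2^3 + A * a2 * s2^4 + B * s2^6)"
    and r3: "\<And>i. r3 i^2 = of_int (a3^3 + A * a3 * s3^4 + B * s3^6)"
    using transfer_rel_three_square_roots[OF 1(4,5) 2(4,5) 3(4,5)] by metis
  interpret transfer_rel M \<rho> by fact
  define P' where "P' i = (of_int (a1 * s1) :: complex, r1 i, of_int (s1^3) :: complex)" for i
  define Q' where "Q' i = (of_int (a2 * s2) :: complex, r2 i, of_int (s2^3) :: complex)" for i
  define W' where "W' i = (of_int (a3 * s3) :: complex, r3 i, of_int (s3^3) :: complex)" for i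
  define p1 where "p1 i = (x1, r1 i / of_int s1^3)" for i
  define p2 where "p2 i = (x2, r2 i / of_int s2^3)" for i
  define p3 where "p3 i = (x3, r3 i / of_int s3^3)" for i
  have P': "P' i = smul (of_int s1^3) (aff (p1 i))" and c1: "on_curve AC BC (p1 i)" for i
    using chart_smul_aff[OF 1(1) r1] by (simp_all only: P'_def p1_def x1_def AC_def BC_def)
  have Q': "Q' i = smul (of_int s2^3) (aff (p2 i))" and c2: "on_curve AC BC (p2 i)" for i
    using chart_smul_aff[OF 2(1) r2] by (simp_all only: Q'_def p2_def x2_def AC_def BC_def)
  have W': "W' i = smul (of_int s3^3) (aff (p3 i))" and c3: "on_curve AC BC (p3 i)" for i
    using chart_smul_aff[OF 3(1) r3] by (simp_all only: W'_def p3_def x3_def AC_def BC_def)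
  have ne: "fst (p1 i) \<noteq> fst (p2 i)" "fst (p1 i) \<noteq> fst (p3 i)" "fst (p2 i) \<noteq> fst (p3 i)" for i
    using x21 x3S by (auto simp: p1_def p2_def p3_def x2_def x3_def S_def)
  have y: "snd (p1 i) \<in> Y x1" "- snd (p1 i) \<in> Y x1" "snd (p2 i) \<in> Y x2" for i
    using c1[of i] c2[of i] by (simp_all add: Y_def on_curve_def p1_def p2_def)
  have in_S: "fst (chord (x1, y1) (x2, y2)) \<in> S" if "y1 \<in> Y x1" "y2 \<in> Y x2" for y1 y2
    unfolding S_def using that by (intro UnI2 image_eqI[of _ _ "(y1, y2)"]) simp_all
  have p12: "p1 i = (x1, snd (p1 i))" "p2 i = (x2, snd (p2 i))" for i
    by (simp_all add: p1_def p2_def)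
  have "fst (chord (p1 i) (p2 i)) \<in> S" "fst (chord (x1, - snd (p1 i)) (p2 i)) \<in> S" for i
    using in_S[OF y(1,3)[of i]] in_S[OF y(2,3)[of i]] by (simp_all only: p12[symmetric])
  then have ne3: "fst (p3 i) \<noteq> fst (chord (p1 i) (p2 i))" "fst (p3 i) \<noteq> fst (chord (x1, - snd (p1 i)) (p2 i))" for i
    using x3S by (metis fst_conv p3_def x3_def)+
  have ne1: "fst (chord (p2 i) (p3 i)) \<noteq> fst (p1 i)" for i
    using fst_chord_swap[of AC BC "fst (p1 i)" "snd (p1 i)" "fst (p2 i)" "snd (p2 i)" "fst (p3 i)" "snd (p3 i)",
        unfolded prod.collapse, OF c1 c2 c3 ne(3) ne(1)] ne3[of i] p12(1)[of i] by (metis fst_conv)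
  have rP: "rel3 P' (a1 * s1, t1, s1^3)" and rQ: "rel3 Q' (a2 * s2, t2, s2^3)"
    and rW: "rel3 W' (a3 * s3, t3, s3^3)"
    unfolding P'_def Q'_def W'_def by (intro rel3_chart \<rho>)+
  note laws = rel3_law[OF rP rQ, where A = A and B = B, folded AC_def BC_def]
  have PQ: "\<exists>k. law i AC BC (P' n) (Q' n) = smul k (aff (chord (p1 n) (p2 n)))" for i n
    unfolding P' Q' using law_smul_aff[OF c1 c2 ne(1)] by metis
  have QW: "\<exists>k. law i AC BC (Q' n) (W' n) = smul k (aff (chord (p2 n) (p3 n)))" for i n
    unfolding Q' W' using law_smul_aff[OF c2 c3 ne(3)] by metis
  have cPQ: "on_curve AC BC (chord (p1 n) (p2 n))" and cQW: "on_curve AC BC (chord (p2 n) (p3 n))" for n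
    using chord_on_curve c1 c2 c3 ne by blast+
  have PQ_W: "\<exists>k. law i AC BC (law j AC BC (P' n) (Q' n)) (W' n) =
      smul k (aff (chord (chord (p1 n) (p2 n)) (p3 n)))" for i j n
    using PQ[of j n] law_smul_aff[OF cPQ c3 ne3(1)[symmetric]] unfolding W' by metis
  have P_QW: "\<exists>k. law i AC BC (P' n) (law j AC BC (Q' n) (W' n)) =
      smul k (aff (chord (p1 n) (chord (p2 n) (p3 n))))" for i j n
    using QW[of j n] law_smul_aff[OF c1 cQW ne1[symmetric]] unfolding P' by metis
  have assoc: "chord (chord (p1 n) (p2 n)) (p3 n) = chord (p1 n) (chord (p2 n) (p3 n))" for n
    using chord_assoc[of AC BC "fst (p1 n)" "snd (p1 n)" "fst (p2 n)" "snd (p2 n)" "fst (p3 n)" "snd (p3 n)"]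
      c1 c2 c3 ne ne3(1)[of n] ne1[of n] by (metis prod.collapse)
  define c where "c = u1^2 * u2^2"
  note nd = 1(2) 2(2) 3(2)
  \<comment> \<open>The second number collects the factors that the two bracketings acquire from u1,
    u2 and u3; by bidegree (2, 2) the factor of an inner law is squared by the outer one.\<close>
  have cop: "coprime c M" "coprime ((u1^2 * u2^2)^2 * u3^2 * (u1^2 * (u2^2 * u3^2)^2)) M"
    unfolding coprime_M c_def using prime nd by (simp_all add: prime_dvd_mult_iff prime_dvd_power_iff)
  have PQc: "cong3 M (law i A B (a1 * s1, t1, s1^3) (a2 * s2, t2, s2^3)) (smul c (law i A B P Q))" for i
    using cong3_law[OF 1(3) 2(3)] by (simp add: law_smul c_def)
  have cross0: "cross (smul k X) (smul l X) = (0, 0, 0)" for k l and X :: "complex \<times> complex \<times> complex"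
    by (simp add: cross_smul)
  show "cong3 M (cross (law i A B P Q) (law j A B P Q)) (0, 0, 0)"
  proof -
    have "cong3 M (cross (law i A B (a1 * s1, t1, s1^3) (a2 * s2, t2, s2^3))
        (law j A B (a1 * s1, t1, s1^3) (a2 * s2, t2, s2^3))) (0, 0, 0)"
      by (rule rel3_sound[OF rel3_cross[OF laws laws]]) (metis PQ cross0)
    then have "cong3 M (cross (smul c (law i A B P Q)) (smul c (law j A B P Q))) (0, 0, 0)"
      using cong3_cross[OF PQc PQc] cong3_trans cong3_sym by blast
    then show ?thesis unfolding cross_smul
      by (rule cong3_smul_zero_cancel) (metis cop(1) coprime_mult_left_iff)
  qed
  show "M dvd cubic A B (law i A B P Q)"
  proof -
    have "cubic AC BC (law i AC BC (P' n) (Q' n)) = 0" for n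
      using PQ[of i n] cubic_smul_aff[OF cPQ] by metis
    then have "M dvd cubic A B (law i A B (a1 * s1, t1, s1^3) (a2 * s2, t2, s2^3))"
      using rel_cubic[OF laws[of i], where A = A and B = B, folded AC_def BC_def] by (simp add: sound)
    then have "M dvd cubic A B (smul c (law i A B P Q))"
      using cong_cubic[OF PQc, of A B i] cong_dvd_iff by blast
    then show ?thesis unfolding cubic_smul
      by (metis cop(1) coprime_commute coprime_dvd_mult_right_iff coprime_power_right_iff)
  qed
  show "cong3 M (cross (law i A B (law j A B P Q) W) (law k A B P (law l A B Q W))) (0, 0, 0)"
  proof -
    let ?P = "(a1 * s1, t1, s1^3)" and ?Q = "(a2 * s2, t2, s2^3)" and ?W = "(a3 * s3, t3, s3^3)"
    have "rel3 (\<lambda>n. cross (law i AC BC (law j AC BC (P' n) (Q' n)) (W' n))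
        (law k AC BC (P' n) (law l AC BC (Q' n) (W' n))))
        (cross (law i A B (law j A B ?P ?Q) ?W) (law k A B ?P (law l A B ?Q ?W)))"
      unfolding AC_def BC_def by (intro rel3_cross rel3_law rP rQ rW)
    moreover have "cross (law i AC BC (law j AC BC (P' n) (Q' n)) (W' n))
        (law k AC BC (P' n) (law l AC BC (Q' n) (W' n))) = (0, 0, 0)" for n
      using PQ_W[where i = i and j = j and n = n] P_QW[where i = k and j = l and n = n] assoc[of n] cross0 by metis
    ultimately have "cong3 M (cross (law i A B (law j A B ?P ?Q) ?W) (law k A B ?P (law l A B ?Q ?W))) (0, 0, 0)"
      by (rule rel3_sound)
    moreover have "cong3 M (cross (law i A B (law j A B ?P ?Q) ?W) (law k A B ?P (law l A B ?Q ?W)))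
      (cross (law i A B (law j A B (smul u1 P) (smul u2 Q)) (smul u3 W))
        (law k A B (smul u1 P) (law l A B (smul u2 Q) (smul u3 W))))"
      by (intro cong3_cross cong3_law 1 2 3)
    ultimately have "cong3 M (cross (law i A B (law j A B (smul u1 P) (smul u2 Q)) (smul u3 W))
        (law k A B (smul u1 P) (law l A B (smul u2 Q) (smul u3 W)))) (0, 0, 0)"
      using cong3_trans cong3_sym by blast
    then show ?thesis unfolding law_smul cross_smul
      by (rule cong3_smul_zero_cancel) (rule cop)
  qed
qed

end

lemma law_commute: "law i A B s t = smul (if i = 1 then 1 else - 1) (law i A B t s)"
proof -
  obtain x y z a b c where st: "s = (x, y, z)" "t = (a, b, c)" by (cases s; cases t)
  consider "i = 0" | "i = 1" | "i > 1" by linarith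
  then show ?thesis
    unfolding st by cases (simp_all add: law_defs smul_def algebra_simps)
qed

lemma law_zero_right:
  "law i A B (x, y, z) (0, 1, 0) = smul (if i = 0 then z else if i = 1 then y else x) (x, y, z)"
  by (simp add: law_defs smul_def power2_eq_square)

lemma law_inverse:
  "\<exists>k. law i A B (x, y, z) (x, - y, z) = smul k (0, 1, 0)"
proof -
  have "law i A B (x, y, z) (x, - y, z) = smul (fst (snd (law i A B (x, y, z) (x, - y, z)))) (0, 1, 0)"
    by (simp add: law_defs smul_def algebra_simps)
  then show ?thesis by blast
qed

context weierstrass_mod
begin

lemma p_gt_1: "p > 1" using prime by (rule prime_gt_1_int)

lemma prim_smul: "\<not> p dvd u \<Longrightarrow> prim (smul u s) \<longleftrightarrow> prim s"
  using prime by (cases s) (simp add: prim_def smul_def prime_dvd_mult_iff)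

lemma prim_smulD: "prim (smul u s) \<Longrightarrow> \<not> p dvd u \<and> prim s"
  using prime by (cases s) (auto simp add: prim_def smul_def prime_dvd_mult_iff)

lemma prim_cong: "cong3 p s t \<Longrightarrow> prim s \<longleftrightarrow> prim t"
  by (cases s; cases t) (auto simp: cong3_def prim_def cong_dvd_iff)

lemma cong3_M_p: "cong3 M s t \<Longrightarrow> cong3 p s t"
  by (cases s; cases t) (auto simp: cong3_def intro: cong_dvd_modulus[OF _ p_dvd_M])

lemma pt_cong: "cong3 M s t \<Longrightarrow> pt s \<longleftrightarrow> pt t"
  using prim_cong[OF cong3_M_p] cong_cubic cong_dvd_iff by (metis pt_def)

lemma pt_smul: "\<not> p dvd u \<Longrightarrow> pt (smul u s) \<longleftrightarrow> pt s"
  unfolding pt_def cubic_smul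
  by (metis prim_smul coprime_M coprime_commute coprime_dvd_mult_right_iff coprime_power_right_iff)

text \<open>The parameter s of \<open>pt_chart\<close> separates the cases: if p divides s, the
  point reduces to the neutral element; otherwise (a / s^2, t / s^3) are its affine coordinates
  modulo p.\<close>

lemma pt_mod_p:
  assumes "pt P"
  obtains (affine) u x y where "\<not> p dvd u" "cong3 p (x, y, 1) (smul u P)" "p dvd y^2 - (x^3 + A * x + B)"
    | (infinite) u where "\<not> p dvd u" "cong3 p (0, 1, 0) (smul u P)"
proof -
  obtain a s t u where *: "\<not> p dvd u" "cong3 M (a * s, t, s^3) (smul u P)"
    "[t^2 = a^3 + A * a * s^4 + B * s^6] (mod M)"
    using pt_chart[OF assms] by metis
  have eq: "[t^2 = a^3 + A * a * s^4 + B * s^6] (mod p)"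
    using *(3) p_dvd_M by (rule cong_dvd_modulus)
  have c: "cong3 p (a * s, t, s^3) (smul u P)" using *(2) by (rule cong3_M_p)
  have pr: "prim (a * s, t, s^3)"
    using prim_cong[OF c] prim_smul[OF *(1)] assms by (simp add: pt_def)
  show thesis
  proof (cases "p dvd s")
    case True
    then have "\<not> p dvd t" using pr by (simp add: prim_def power3_eq_cube)
    then obtain w where w: "[t * w = 1] (mod M)" "\<not> p dvd w" by (rule inverse_mod)
    have "[t * w = 1] (mod p)" using w(1) p_dvd_M by (rule cong_dvd_modulus)
    moreover have "p dvd w * (a * s)" "p dvd w * s^3" using True by (simp_all add: power3_eq_cube)
    ultimately have "cong3 p (smul w (a * s, t, s^3)) (0, 1, 0)"
      by (simp add: cong3_def smul_def cong_0_iff mult.commute)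
    then have "cong3 p (0, 1, 0) (smul w (a * s, t, s^3))" by (rule cong3_sym)
    then have "cong3 p (0, 1, 0) (smul (w * u) P)"
      using cong3_trans[OF _ cong3_smul[OF c cong_refl, of w]] by (simp only: smul_smul)
    moreover have "\<not> p dvd w * u" using w(2) *(1) prime prime_dvd_mult_iff by blast
    ultimately show thesis using infinite by blast
  next
    case False
    then obtain w where w: "[s * w = 1] (mod M)" "\<not> p dvd w" by (rule inverse_mod)
    have w1: "[s * w = 1] (mod p)" using w(1) p_dvd_M by (rule cong_dvd_modulus)
    have "[(a * w^2) * 1 = (a * w^2) * (s * w)] (mod p)" "[1^3 = (s * w)^3] (mod p)"
      by (intro cong_mult cong_refl cong_pow cong_sym[OF w1])+
    moreover have "(a * w^2) * (s * w) = w^3 * (a * s)" "(s * w)^3 = w^3 * s^3"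
      by (simp_all add: power2_eq_square power3_eq_cube)
    ultimately have "[a * w^2 = w^3 * (a * s)] (mod p)" "[1 = w^3 * s^3] (mod p)" by simp_all
    then have "cong3 p (a * w^2, w^3 * t, 1) (smul (w^3) (a * s, t, s^3))"
      by (simp add: cong3_def smul_def)
    then have "cong3 p (a * w^2, w^3 * t, 1) (smul (w^3 * u) P)"
      using cong3_trans[OF _ cong3_smul[OF c cong_refl, of "w^3"]] by (simp only: smul_smul)
    moreover have "\<not> p dvd w^3 * u" using w(2) *(1) prime by (simp add: prime_dvd_mult_iff prime_dvd_power_iff)
    moreover have "p dvd (w^3 * t)^2 - ((a * w^2)^3 + A * (a * w^2) + B)"
    proof -
      have "[w^6 * t^2 = w^6 * (a^3 + A * a * s^4 + B * s^6)] (mod p)"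
        by (intro cong_mult cong_refl eq)
      also have "w^6 * (a^3 + A * a * s^4 + B * s^6) = (a * w^2)^3 + A * (a * w^2) * (s * w)^4 + B * (s * w)^6"
        by (simp add: eval_nat_numeral algebra_simps)
      also have "[\<dots> = (a * w^2)^3 + A * (a * w^2) * 1^4 + B * 1^6] (mod p)"
        by (intro cong_add cong_mult cong_pow cong_refl w1)
      finally show ?thesis by (simp add: cong_iff_dvd_diff eval_nat_numeral algebra_simps)
    qed
    ultimately show thesis using affine by blast
  qed
qed

text \<open>The last two clauses match the two inclusions for \<open>curve_add\<close>: if all law
  values are multiples of R, every primitive combination lies in the class of R; if one value is a
  unit multiple, every member of that class occurs.\<close>

definition sums_to :: "int \<times> int \<times> int \<Rightarrow> int \<times> int \<times> int \<Rightarrow> int \<times> int \<times> int \<Rightarrow> bool"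
  where "sums_to P Q R \<longleftrightarrow> pt R \<and> (\<forall>i. \<exists>k. cong3 M (law i A B P Q) (smul k R)) \<and>
    (\<exists>i k. \<not> p dvd k \<and> cong3 M (law i A B P Q) (smul k R))"

text \<open>A coordinate of R that is prime to p can be inverted and fixes the factor k; the minors
  then force the other two coordinates.\<close>

lemma proportional:
  assumes "prim R" "cong3 M (cross R S) (0, 0, 0)"
  obtains k where "cong3 M S (smul k R)"
proof -
  obtain x y z x' y' z' where RS: "R = (x, y, z)" "S = (x', y', z')" by (cases R; cases S)
  have c: "[y * z' = z * y'] (mod M)" "[z * x' = x * z'] (mod M)" "[x * y' = y * x'] (mod M)"
    using assms(2) by (simp_all add: RS cross_def cong3_def cong_0_iff cong_iff_dvd_diff)
  have key: "[b' = b * (a' * v)] (mod M)"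
    if "[a * v = 1] (mod M)" "[a * b' = b * a'] (mod M)" for a v b a' b'
  proof -
    have "[v * (a * b') = v * (b * a')] (mod M)" by (intro cong_mult cong_refl that)
    moreover have "[(a * v) * b' = 1 * b'] (mod M)" by (intro cong_mult cong_refl that)
    moreover have "v * (a * b') = (a * v) * b'" "v * (b * a') = b * (a' * v)" by (simp_all add: ac_simps)
    ultimately show ?thesis using cong_trans[OF cong_sym] by (metis mult_1)
  qed
  have self: "[a' = a * (a' * v)] (mod M)" if "[a * v = 1] (mod M)" for a v a'
    using key[OF that, of a' a a'] by simp
  consider "\<not> p dvd x" | "\<not> p dvd y" | "\<not> p dvd z" using assms(1) by (auto simp: RS prim_def)
  then have "\<exists>k. cong3 M S (smul k R)"
  proof cases
    case 1
    then obtain v where v: "[x * v = 1] (mod M)" by (rule inverse_mod)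
    show ?thesis
      using self[OF v, of x'] key[OF v c(3)] key[OF v cong_sym[OF c(2)]]
      by (intro exI[of _ "x' * v"]) (simp add: RS smul_def cong3_def mult.commute)
  next
    case 2
    then obtain v where v: "[y * v = 1] (mod M)" by (rule inverse_mod)
    show ?thesis
      using self[OF v, of y'] key[OF v c(1)] key[OF v cong_sym[OF c(3)]]
      by (intro exI[of _ "y' * v"]) (simp add: RS smul_def cong3_def mult.commute)
  next
    case 3
    then obtain v where v: "[z * v = 1] (mod M)" by (rule inverse_mod)
    show ?thesis
      using self[OF v, of z'] key[OF v c(2)] key[OF v cong_sym[OF c(1)]]
      by (intro exI[of _ "z' * v"]) (simp add: RS smul_def cong3_def mult.commute)
  qed
  then show thesis using that by blast
qed

lemma proportional_unit:
  assumes "prim R" "prim S" "cong3 M (cross R S) (0, 0, 0)"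
  obtains k where "\<not> p dvd k" "cong3 M S (smul k R)"
proof -
  obtain k where k: "cong3 M S (smul k R)" using proportional[OF assms(1,3)] by blast
  then have "prim (smul k R)" using assms(2) prim_cong[OF cong3_M_p] by blast
  then show thesis using that k prim_smulD by blast
qed

end

section \<open>Nonsingular curves: some addition law has a primitive value\<close>

locale elliptic_mod = weierstrass_mod +
  assumes p_odd: "p \<noteq> 2" and disc: "\<not> p dvd 4 * A^3 + 27 * B^2"
begin

lemma not_p_dvd_2: "\<not> p dvd 2"
proof
  assume "p dvd 2"
  then have "p \<le> 2" by (rule zdvd_imp_le) simp
  then show False using p_gt_1 p_odd by simp
qed

lemma simple_root:
  assumes "p dvd x^3 + A * x + B"
  shows "\<not> p dvd 3 * x^2 + A"
proof
  assume "p dvd 3 * x^2 + A"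
  \<comment> \<open>A Bezout identity that expresses the discriminant, up to sign, through x^3 + A x
    + B and the square of its derivative.\<close>
  then have "p dvd (3 * x^2 + 4 * A) * (3 * x^2 + A) * (3 * x^2 + A) - 27 * (x^3 + A * x - B) * (x^3 + A * x + B)"
    using assms by (intro dvd_diff dvd_mult)
  also have "\<dots> = 4 * A^3 + 27 * B^2" by Groebner_Basis.algebra
  finally show False using disc by simp
qed

text \<open>If every law vanished modulo p, the third coordinate of the first law, which is - (x1 -
  x2)^3 on the curve, would give x1 = x2, so the points would be equal or opposite. A coordinate of
  the second law or of the first law is then 8 y1^3 on the curve, so y1 = 0 because p is odd, and x1
  would be a multiple root of x^3 + A x + B.\<close>

lemma law_prim_affine:
  assumes E1: "p dvd y1^2 - (x1^3 + A * x1 + B)" and E2: "p dvd y2^2 - (x2^3 + A * x2 + B)"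
  shows "\<exists>i. prim (law i A B (x1, y1, 1) (x2, y2, 1))"
proof (rule ccontr)
  assume "\<not> ?thesis"
  then have np: "\<not> prim (law i A B (x1, y1, 1) (x2, y2, 1))" for i by blast
  have np': "\<not> prim (law i A B s t)"
    if "cong3 p s (x1, y1, 1)" "cong3 p t (x2, y2, 1)" for s t i
    using np[of i] prim_cong[OF cong3_law[OF that]] by blast
  have Z: "snd (snd (law 0 A B (x1, y1, 1) (x2, y2, 1))) =
      3 * (x1 * x2) * (x1 - x2) - (y1 + y2) * (y1 - y2) + A * (x1 - x2)"
    by (simp add: law_defs)
  have "p dvd snd (snd (law 0 A B (x1, y1, 1) (x2, y2, 1))) +
      ((y1^2 - (x1^3 + A * x1 + B)) - (y2^2 - (x2^3 + A * x2 + B)))"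
    using np[of 0] by (intro dvd_add[OF _ dvd_diff[OF E1 E2]]) (auto simp: prim_def case_prod_beta)
  also have "\<dots> = - ((x1 - x2)^3)"
    unfolding Z by Groebner_Basis.algebra
  finally have dx: "p dvd x1 - x2" 
    by (simp add: prime_dvd_power_iff[OF prime])
  then have x: "[x1 = x2] (mod p)" by (simp add: cong_iff_dvd_diff)
  have "[x1^3 + A * x1 + B = x2^3 + A * x2 + B] (mod p)"
    by (intro cong_add cong_mult cong_pow cong_refl x)
  then have "p dvd (y1^2 - (x1^3 + A * x1 + B)) - (y2^2 - (x2^3 + A * x2 + B)) +
      (x1^3 + A * x1 + B - (x2^3 + A * x2 + B))"
    by (intro dvd_add[OF dvd_diff[OF E1 E2]]) (simp add: cong_iff_dvd_diff)
  also have "\<dots> = (y1 - y2) * (y1 + y2)" by (simp add: algebra_simps power2_eq_square)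
  finally consider "p dvd y1 - y2" | "p dvd y1 + y2" using prime prime_dvd_mult_iff by blast
  then have y: "p dvd y1 \<and> p dvd y2"
  proof cases
    case 1
    then have yy: "[y1 = y2] (mod p)" by (simp add: cong_iff_dvd_diff)
    then have "\<not> prim (law 1 A B (x1, y1, 1) (x1, y1, 1))" using x by (intro np') (simp_all add: cong3_def)
    then have "p dvd snd (snd (law 1 A B (x1, y1, 1) (x1, y1, 1))) + 6 * y1 * (y1^2 - (x1^3 + A * x1 + B))"
      by (intro dvd_add[OF _ dvd_mult[OF E1]]) (auto simp: prim_def case_prod_beta)
    also have "\<dots> = 2 ^ 3 * y1 ^ 3"
      by (simp add: law_defs) Groebner_Basis.algebra
    finally have "p dvd y1" using not_p_dvd_2 prime by (metis prime_dvd_mult_iff prime_dvd_power)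
    then show ?thesis using yy cong_dvd_iff by blast
  next
    case 2
    then have yy: "[- y1 = y2] (mod p)" by (simp add: cong_iff_dvd_diff) (metis add.commute minus_add dvd_minus_iff diff_conv_add_uminus)
    then have "\<not> prim (law 0 A B (x1, y1, 1) (x1, - y1, 1))" using x by (intro np') (simp_all add: cong3_def)
    then have "p dvd fst (snd (law 0 A B (x1, y1, 1) (x1, - y1, 1))) + 6 * y1 * (y1^2 - (x1^3 + A * x1 + B))"
      by (intro dvd_add[OF _ dvd_mult[OF E1]]) (auto simp: prim_def case_prod_beta)
    also have "\<dots> = 2 ^ 3 * y1 ^ 3"
      by (simp add: law_defs) Groebner_Basis.algebra
    finally have "p dvd y1" using not_p_dvd_2 prime by (metis prime_dvd_mult_iff prime_dvd_power)
    then show ?thesis using yy cong_dvd_iff by (metis dvd_minus_iff)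
  qed
  then have root: "p dvd x1^3 + A * x1 + B"
    using E1 by (metis dvd_diff_commute dvd_add_right_iff diff_add_cancel dvd_power dvd_trans pos2)
  txt \<open>Modulo \<open>x\<^sup>3 + A x + B\<close> the doubling law at \<open>(x : 0 : 1)\<close> takes the value \<open>(0 : - (3 x\<^sup>2 + A)\<^sup>3 : 0)\<close>.\<close>
  have "\<not> prim (law 1 A B (x1, 0, 1) (x1, 0, 1))"
    using x y by (intro np') (simp_all add: cong3_def cong_sym_eq[of 0] cong_0_iff)
  then have "p dvd (27 * x1^3 + 3 * A * x1 - 9 * B) * (x1^3 + A * x1 + B) - fst (snd (law 1 A B (x1, 0, 1) (x1, 0, 1)))"
    by (intro dvd_diff[OF dvd_mult[OF root]]) (auto simp: prim_def case_prod_beta)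
  also have "\<dots> = (3 * x1^2 + A)^3"
    by (simp add: law_defs) Groebner_Basis.algebra
  finally have "p dvd 3 * x1^2 + A" using prime prime_dvd_power by blast
  then show False using simple_root[OF root] by blast
qed

lemma law_prim_zero_right: "prim P \<Longrightarrow> \<exists>i. prim (law i A B P (0, 1, 0))"
proof -
  assume P: "prim P"
  obtain x y z where xyz: "P = (x, y, z)" by (cases P)
  consider "\<not> p dvd x" | "\<not> p dvd y" | "\<not> p dvd z" using P by (auto simp: xyz prim_def)
  then show ?thesis
  proof cases
    case 1 then show ?thesis using prim_smul P xyz law_zero_right[of 2 A B x y z] by (intro exI[of _ 2]) simp
  next
    case 2 then show ?thesis using prim_smul P xyz law_zero_right[of 1 A B x y z] by (intro exI[of _ 1]) simp
  next
    case 3 then show ?thesis using prim_smul P xyz law_zero_right[of 0 A B x y z] by (intro exI[of _ 0]) simp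
  qed
qed

lemma prim_uminus: "prim (smul (-1) s) = prim s" by (cases s) (simp add: smul_def prim_def)

lemma prim_law_commute: "prim (law i A B P Q) = prim (law i A B Q P)"
  by (subst law_commute) (simp add: prim_uminus)

text \<open>Whether a law value is primitive depends only on the residues modulo p and not on unit
  factors, so the representatives of \<open>pt_mod_p\<close> may be used.\<close>

lemma law_prim:
  assumes "pt P" "pt Q"
  shows "\<exists>i. prim (law i A B P Q)"
proof -
  have tr: "\<exists>i. prim (law i A B P Q)"
    if h: "\<not> p dvd u" "cong3 p s (smul u P)" "\<not> p dvd v" "cong3 p t (smul v Q)" "\<exists>i. prim (law i A B s t)" for u v s t
  proof -
    obtain i where "prim (law i A B s t)" using h(5) by blast
    then have "prim (law i A B (smul u P) (smul v Q))" using prim_cong[OF cong3_law[OF h(2,4)]] by blast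
    then show ?thesis unfolding law_smul using prim_smulD by blast
  qed
  show ?thesis
  proof (rule pt_mod_p[OF assms(1)])
    fix u assume "\<not> p dvd u" "cong3 p (0, 1, 0) (smul u P)"
    moreover have "\<exists>i. prim (law i A B (0, 1, 0) Q)"
      using law_prim_zero_right[of Q] assms(2) prim_law_commute by (auto simp: pt_def)
    ultimately show ?thesis using tr[of u "(0, 1, 0)" 1 Q] p_gt_1 by (simp)
  next
    fix u x y assume 1: "\<not> p dvd u" "cong3 p (x, y, 1) (smul u P)" "p dvd y^2 - (x^3 + A * x + B)"
    show ?thesis
    proof (rule pt_mod_p[OF assms(2)])
      fix v assume 2: "\<not> p dvd v" "cong3 p (0, 1, 0) (smul v Q)"
      have "prim (x, y, 1)" using p_gt_1 by (auto simp add: prim_def)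
      then show ?thesis using tr[OF 1(1,2) 2] law_prim_zero_right by blast
    next
      fix v x' y' assume 2: "\<not> p dvd v" "cong3 p (x', y', 1) (smul v Q)" "p dvd y'^2 - (x'^3 + A * x' + B)"
      then show ?thesis using tr[OF 1(1,2) 2(1,2)] law_prim_affine[OF 1(3) 2(3)] by blast
    qed
  qed
qed

lemma sums_to_exists:
  assumes "pt P" "pt Q"
  obtains R where "sums_to P Q R"
proof -
  obtain i where i: "prim (law i A B P Q)" using law_prim[OF assms] by blast
  have "sums_to P Q (law i A B P Q)"
    unfolding sums_to_def
  proof (intro conjI allI)
    show "pt (law i A B P Q)" using i law_cubic[OF assms assms(1)] by (simp add: pt_def)
    show "\<exists>k. cong3 M (law j A B P Q) (smul k (law i A B P Q))" for j
      using proportional[OF i law_minors[OF assms assms(1)]] by blast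
    show "\<exists>j k. \<not> p dvd k \<and> cong3 M (law j A B P Q) (smul k (law i A B P Q))"
      using p_gt_1 by (intro exI[of _ i] exI[of _ 1]) (simp)
  qed
  then show thesis by (rule that)
qed

end

section \<open>The group of points\<close>

definition mod3 :: "int \<Rightarrow> int \<times> int \<times> int \<Rightarrow> int \<times> int \<times> int"
  where "mod3 m = (\<lambda>(x, y, z). (x mod m, y mod m, z mod m))"

lemma mod3_eq_iff: "mod3 m s = mod3 m t \<longleftrightarrow> cong3 m s t"
  by (cases s; cases t) (simp add: mod3_def cong3_def cong_def)

lemma cong3_mod3 [simp]: "cong3 m (mod3 m s) s"
  by (cases s) (simp add: mod3_def cong3_def cong_def)

definition lin3 :: "int \<Rightarrow> int \<times> int \<times> int \<Rightarrow> int \<Rightarrow> int \<times> int \<times> int \<Rightarrow> int \<Rightarrow> int \<times> int \<times> int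
    \<Rightarrow> int \<times> int \<times> int"
  where "lin3 a s b t c u = (a * fst s + b * fst t + c * fst u,
    a * fst (snd s) + b * fst (snd t) + c * fst (snd u),
    a * snd (snd s) + b * snd (snd t) + c * snd (snd u))"

lemma cong3_lin3:
  assumes "cong3 m s s'" "cong3 m t t'" "cong3 m u u'"
  shows "cong3 m (lin3 a s b t c u) (lin3 a s' b t' c u')"
  using assms by (cases s; cases t; cases u; cases s'; cases t'; cases u')
    (auto simp: cong3_def lin3_def intro!: cong_add cong_mult)

lemma lin3_smul: "lin3 a (smul k s) b (smul l s) c (smul n s) = smul (a * k + b * l + c * n) s"
  by (cases s) (simp add: lin3_def smul_def algebra_simps)

context
  fixes m :: int
  assumes m: "m > 1"
begin

interpretation residues m "residue_ring m"
  using m by unfold_locales simp_all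

lemma residue_ring_pow: "x [^]\<^bsub>residue_ring m\<^esub> (n :: nat) = x ^ n mod m"
proof (induction n)
  case 0 then show ?case using m by (simp add: res_one_eq)
next
  case (Suc n) then show ?case by (simp add: res_mult_eq mod_mult_left_eq mod_mult_right_eq mult.commute)
qed

lemma residue_ring_add_pow: "[n] \<cdot>\<^bsub>residue_ring m\<^esub> x = (int n * x) mod m"
proof (induction n)
  case 0 then show ?case by (simp add: res_zero_eq)
next
  case (Suc n) then show ?case by (simp add: res_add_eq mod_add_left_eq mod_add_right_eq algebra_simps)
qed

lemma residue_ring_minus: "x \<ominus>\<^bsub>residue_ring m\<^esub> y = (x - y) mod m"
  by (simp add: a_minus_def res_add_eq res_neg_eq mod_simps)

lemmas residue_ring_simps = res_add_eq res_mult_eq res_neg_eq residue_ring_minus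
  residue_ring_pow residue_ring_add_pow

text \<open>The rule from \<open>cong_mod_left\<close> strips the inner reductions left by the ring
  operations, so that each expression is compared with its integer counterpart term by term.\<close>

lemmas cong_arith_intros = cong_diff cong_uminus cong_add cong_mult cong_pow
  iffD2[OF cong_mod_left] cong_refl

lemma add_law1_residue_ring: "add_law1 (residue_ring m) A B s t = mod3 m (law 0 A B s t)"
proof -
  obtain x y z a b c where st: "s = (x, y, z)" "t = (a, b, c)" by (cases s; cases t)
  have l: "law 0 = law1" by (simp add: law_def fun_eq_iff)
  then show ?thesis
    unfolding st by (simp only: l add_law1_def law1_def Let_def prod.case mod3_def residue_ring_simps
      of_nat_numeral prod.inject flip: cong_def; intro conjI cong_arith_intros)
qed

lemma add_law2_residue_ring: "add_law2 (residue_ring m) A B s t = mod3 m (law 1 A B s t)"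
proof -
  obtain x y z a b c where st: "s = (x, y, z)" "t = (a, b, c)" by (cases s; cases t)
  have l: "law 1 = law2" by (simp add: law_def fun_eq_iff)
  then show ?thesis
    unfolding st by (simp only: l add_law2_def law2_def Let_def prod.case mod3_def residue_ring_simps
      of_nat_numeral prod.inject flip: cong_def; intro conjI cong_arith_intros)
qed

lemma add_law3_residue_ring: "add_law3 (residue_ring m) A B s t = mod3 m (law 2 A B s t)"
proof -
  obtain x y z a b c where st: "s = (x, y, z)" "t = (a, b, c)" by (cases s; cases t)
  have l: "law 2 = law3" by (simp add: law_def fun_eq_iff)
  then show ?thesis
    unfolding st by (simp only: l add_law3_def law3_def Let_def prod.case mod3_def residue_ring_simps
      of_nat_numeral prod.inject flip: cong_def; intro conjI cong_arith_intros)
qed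

lemma lin_comb3_residue_ring:
  "lin_comb3 (residue_ring m) a s b t c u = mod3 m (lin3 a s b t c u)"
proof -
  obtain s1 s2 s3 t1 t2 t3 u1 u2 u3 where st: "s = (s1, s2, s3)" "t = (t1, t2, t3)" "u = (u1, u2, u3)"
    by (cases s; cases t; cases u)
  show ?thesis
    unfolding st by (simp only: lin_comb3_def lin3_def fst_conv snd_conv prod.case mod3_def residue_ring_simps
      prod.inject flip: cong_def; intro conjI cong_arith_intros)
qed

lemma weierstrass_eq_residue_ring:
  "weierstrass_eq (residue_ring m) A B s \<longleftrightarrow> m dvd cubic A B s"
proof -
  obtain x y z where s: "s = (x, y, z)" by (cases s)
  define l where "l = (y^2 mod m * z) mod m"
  define r where "r = ((x^3 mod m + (A * x mod m * (z^2 mod m)) mod m) mod m + (B * (z^3 mod m)) mod m) mod m"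
  have "weierstrass_eq (residue_ring m) A B s \<longleftrightarrow> l = r"
    unfolding s by (simp only: weierstrass_eq_def prod.case residue_ring_simps l_def r_def)
  also have "\<dots> \<longleftrightarrow> [l = r] (mod m)" by (simp add: cong_def l_def r_def)
  also have "\<dots> \<longleftrightarrow> [y^2 * z = x^3 + A * x * z^2 + B * z^3] (mod m)"
  proof -
    have "[l = y^2 * z] (mod m)" "[r = x^3 + A * x * z^2 + B * z^3] (mod m)"
      unfolding l_def r_def by (intro cong_arith_intros)+
    then show ?thesis by (simp add: cong_def)
  qed
  finally show ?thesis by (simp add: s cubic_def cong_iff_dvd_diff)
qed

lemma scale_residue_ring: "scale (residue_ring m) u s = mod3 m (smul u s)"
  by (cases s) (simp add: scale_def mod3_def smul_def residue_ring_simps)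

lemma weierstrass_disc_residue_ring:
  "[weierstrass_disc (residue_ring m) A B = - (4 * A^3 + 27 * B^2)] (mod m)"
  by (simp only: weierstrass_disc_def residue_ring_simps of_nat_numeral; intro cong_arith_intros)

lemma Units_residue_ring: "u \<in> Units (residue_ring m) \<longleftrightarrow> 0 \<le> u \<and> u < m \<and> coprime u m"
  unfolding res_units_eq using m by (cases "u = 0") auto

lemma carrier_residue_ring: "carrier (residue_ring m) = {0..m - 1}"
  by (rule res_carrier_eq)

end

context weierstrass_mod
begin

abbreviation R where "R \<equiv> residue_ring M"

lemma mod3_in_carrier: "mod3 M s = (x, y, z) \<Longrightarrow> x \<in> carrier R \<and> y \<in> carrier R \<and> z \<in> carrier R"
  using M_pos by (cases s) (auto simp: mod3_def carrier_residue_ring)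

lemma mod3_carrier_id: "x \<in> carrier R \<Longrightarrow> y \<in> carrier R \<Longrightarrow> z \<in> carrier R \<Longrightarrow> mod3 M (x, y, z) = (x, y, z)"
  using M_pos by (auto simp: mod3_def carrier_residue_ring)

lemma genideal_carrier_iff:
  assumes c: "x \<in> carrier R" "y \<in> carrier R" "z \<in> carrier R"
  shows "genideal R {x, y, z} = carrier R \<longleftrightarrow> prim (x, y, z)"
proof -
  interpret residues M R using M_pos by unfold_locales simp_all
  have S: "{x, y, z} \<subseteq> carrier R" using c by simp
  have I: "ideal (genideal R {x, y, z}) R" using genideal_ideal[OF S] .
  show ?thesis
  proof
    assume eq: "genideal R {x, y, z} = carrier R"
    \<comment> \<open>The maximal ideal; for \<open>e = 1\<close> its generator is 0. A triple
      without a unit coordinate stays inside it, and it misses 1.\<close>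
    let ?J = "PIdl\<^bsub>R\<^esub> (p mod M)"
    have pc: "p mod M \<in> carrier R" by simp
    have J: "r \<in> ?J \<longleftrightarrow> r \<in> carrier R \<and> p dvd r" for r
    proof
      assume "r \<in> ?J"
      then obtain k where "k \<in> carrier R" "r = k \<otimes>\<^bsub>R\<^esub> (p mod M)" by (auto simp: cgenideal_def)
      then show "r \<in> carrier R \<and> p dvd r"
        using p_dvd_M M_pos by (auto simp: residue_ring_simps mod_simps dvd_mod_iff carrier_residue_ring)
    next
      assume r: "r \<in> carrier R \<and> p dvd r"
      then obtain k where k: "r = p * k" by blast
      have "r mod M = r" using r by (simp add: carrier_residue_ring M_pos)
      then have "r = (k mod M) \<otimes>\<^bsub>R\<^esub> (p mod M)"
        using k by (simp add: residue_ring_simps M_pos mod_simps mult.commute)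
      then show "r \<in> ?J" unfolding cgenideal_def by blast
    qed
    show "prim (x, y, z)"
    proof (rule ccontr)
      assume "\<not> prim (x, y, z)"
      then have "{x, y, z} \<subseteq> ?J" using c J by (simp add: prim_def)
      then have "genideal R {x, y, z} \<subseteq> ?J"
        using cgenideal_ideal[OF pc] genideal_minimal by blast
      then have "1 \<in> ?J" using eq one_closed res_one_eq by auto
      then show False using J p_gt_1 by simp
    qed
  next
    assume "prim (x, y, z)"
    then obtain u where u: "u \<in> {x, y, z}" "\<not> p dvd u" by (auto simp: prim_def)
    have "u \<in> Units R"
      using u c unfolding Units_residue_ring[OF M_pos] coprime_M by (auto simp: carrier_residue_ring M_pos)
    moreover have "u \<in> genideal R {x, y, z}" using genideal_self[OF S] u(1) by blast
    ultimately show "genideal R {x, y, z} = carrier R"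
      using ideal.I_l_closed[OF I] ideal.one_imp_carrier[OF I] Units_l_inv Units_inv_closed by metis
  qed
qed

lemma primitive_triples_iff: "s \<in> primitive_triples R \<longleftrightarrow> mod3 M s = s \<and> prim s"
proof -
  obtain x y z where s: "s = (x, y, z)" by (cases s)
  have "mod3 M s = s \<longleftrightarrow> x \<in> carrier R \<and> y \<in> carrier R \<and> z \<in> carrier R"
    using mod3_in_carrier[of s] mod3_carrier_id s by metis
  then show ?thesis unfolding primitive_triples_def s using genideal_carrier_iff by auto
qed

text \<open>The class is named by an arbitrary integer triple, and the factors are arbitrary
  integers prime to p, so that neither has to be reduced in computations.\<close>

definition cls :: "int \<times> int \<times> int \<Rightarrow> (int \<times> int \<times> int) set"
  where "cls s = {mod3 M (smul u s) | u. \<not> p dvd u}"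

lemma prim_mod3 [simp]: "prim (mod3 M s) \<longleftrightarrow> prim s"
  using prim_cong[OF cong3_M_p[OF cong3_mod3]] .

lemma mod3_mod3 [simp]: "mod3 M (mod3 M s) = mod3 M s"
  by (simp add: mod3_eq_iff)

lemma proj_rel_image:
  assumes "prim s"
  shows "proj_rel R `` {mod3 M s} = cls s"
proof -
  have sc: "mod3 M (smul u (mod3 M s)) = mod3 M (smul (u mod M) s)"
    "mod3 M (smul u s) = mod3 M (smul (u mod M) s)" for u
    by (simp_all add: mod3_eq_iff cong3_smul)
  have "t \<in> proj_rel R `` {mod3 M s} \<longleftrightarrow> t \<in> cls s" for t
  proof
    assume "t \<in> proj_rel R `` {mod3 M s}"
    then obtain u where "u \<in> Units R" "t = scale R u (mod3 M s)"
      by (auto simp: proj_rel_def)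
    then have "\<not> p dvd u" "t = mod3 M (smul u s)"
      using sc coprime_M by (auto simp: Units_residue_ring[OF M_pos] scale_residue_ring[OF M_pos])
    then show "t \<in> cls s" unfolding cls_def by blast
  next
    assume "t \<in> cls s"
    then obtain u where u: "\<not> p dvd u" "t = mod3 M (smul u s)" unfolding cls_def by blast
    have 1: "u mod M \<in> Units R"
      using u(1) M_pos p_dvd_M unfolding Units_residue_ring[OF M_pos] coprime_M by (simp add: dvd_mod_iff)
    have 2: "t = scale R (u mod M) (mod3 M s)"
      using u(2) sc by (simp add: scale_residue_ring[OF M_pos])
    have "t \<in> primitive_triples R" "mod3 M s \<in> primitive_triples R"
      using u assms by (simp_all add: primitive_triples_iff prim_smul)
    then show "t \<in> proj_rel R `` {mod3 M s}" using 1 2 by (auto simp: proj_rel_def)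
  qed
  then show ?thesis by blast
qed

lemma proj_point_eq_cls: "prim (x, y, z) \<Longrightarrow> mod3 M (x, y, z) = (x, y, z) \<Longrightarrow> proj_point R x y z = cls (x, y, z)"
  unfolding proj_point_def using proj_rel_image[of "(x, y, z)"] by simp

lemma cls_eq_iff:
  assumes "prim s"
  shows "cls s = cls t \<longleftrightarrow> (\<exists>u. \<not> p dvd u \<and> cong3 M t (smul u s))"
proof
  assume "cls s = cls t"
  moreover have "mod3 M t \<in> cls t"
    unfolding cls_def using p_gt_1 by (intro CollectI exI[of _ 1]) simp
  ultimately obtain u where "\<not> p dvd u" "mod3 M t = mod3 M (smul u s)" unfolding cls_def by blast
  then show "\<exists>u. \<not> p dvd u \<and> cong3 M t (smul u s)" by (auto simp: mod3_eq_iff)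
next
  assume "\<exists>u. \<not> p dvd u \<and> cong3 M t (smul u s)"
  then obtain u where u: "\<not> p dvd u" "cong3 M t (smul u s)" by blast
  obtain v where v: "[u * v = 1] (mod M)" "\<not> p dvd v" using u(1) by (rule inverse_mod)
  have nd: "\<not> p dvd a * b" if "\<not> p dvd a" "\<not> p dvd b" for a b
    using that prime prime_dvd_mult_iff by blast
  have t: "cong3 M (smul w t) (smul (w * u) s)" for w
    using cong3_smul[OF u(2) cong_refl, of w] by (simp add: smul_smul)
  have s: "cong3 M (smul w s) (smul (w * v) t)" for w
  proof -
    have "[w * v * u = w * 1] (mod M)"
      using cong_mult[OF cong_refl v(1), of w] by (simp add: ac_simps)
    then have "cong3 M (smul (w * v * u) s) (smul w s)" using cong3_smul[OF cong3_refl, of "w * v * u" w M s] by simp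
    then show ?thesis using t[of "w * v"] cong3_trans cong3_sym by blast
  qed
  show "cls s = cls t"
  proof (intro subset_antisym subsetI)
    fix r assume "r \<in> cls s"
    then obtain w where "\<not> p dvd w" "r = mod3 M (smul w s)" unfolding cls_def by blast
    then have "r = mod3 M (smul (w * v) t)" "\<not> p dvd w * v" using s nd v(2) by (simp_all add: mod3_eq_iff)
    then show "r \<in> cls t" unfolding cls_def by blast
  next
    fix r assume "r \<in> cls t"
    then obtain w where "\<not> p dvd w" "r = mod3 M (smul w t)" unfolding cls_def by blast
    then have "r = mod3 M (smul (w * u) s)" "\<not> p dvd w * u" using t nd u(1) by (simp_all add: mod3_eq_iff)
    then show "r \<in> cls s" unfolding cls_def by blast
  qed
qed

lemma proj_plane_eq: "proj_plane R = cls ` {s. prim s}"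
proof -
  have "proj_plane R = (\<lambda>s. proj_rel R `` {s}) ` primitive_triples R"
    unfolding proj_plane_def quotient_def by blast
  also have "\<dots> = cls ` {s. prim s}"
  proof (intro subset_antisym subsetI)
    fix P assume "P \<in> (\<lambda>s. proj_rel R `` {s}) ` primitive_triples R"
    then obtain s where "mod3 M s = s" "prim s" "P = proj_rel R `` {s}"
      by (auto simp: primitive_triples_iff)
    then show "P \<in> cls ` {s. prim s}" using proj_rel_image[of s] by auto
  next
    fix P assume "P \<in> cls ` {s. prim s}"
    then obtain s where "prim s" "P = cls s" by blast
    then show "P \<in> (\<lambda>s. proj_rel R `` {s}) ` primitive_triples R"
      using proj_rel_image[of s] by (intro image_eqI[of _ _ "mod3 M s"]) (simp_all add: primitive_triples_iff)
  qed
  finally show ?thesis .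
qed

lemma in_cls_self: "mod3 M s \<in> cls s"
  unfolding cls_def using p_gt_1 by (intro CollectI exI[of _ 1]) simp

lemma curve_points_eq: "curve_points R A B = cls ` {s. pt s}"
proof -
  have "(\<forall>t\<in>cls s. weierstrass_eq R A B t) \<longleftrightarrow> M dvd cubic A B s" if "prim s" for s
  proof
    assume "\<forall>t\<in>cls s. weierstrass_eq R A B t"
    then have "M dvd cubic A B (mod3 M s)" using in_cls_self by (simp add: weierstrass_eq_residue_ring M_pos)
    then show "M dvd cubic A B s" using cong_cubic[OF cong3_mod3] cong_dvd_iff by blast
  next
    assume s: "M dvd cubic A B s"
    have "M dvd cubic A B (mod3 M (smul u s))" for u
    proof -
      have "M dvd cubic A B (smul u s)" using s by (simp add: cubic_smul)
      then show ?thesis using cong_cubic[OF cong3_mod3] cong_dvd_iff by blast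
    qed
    then show "\<forall>t\<in>cls s. weierstrass_eq R A B t" 
      by (auto simp: cls_def weierstrass_eq_residue_ring M_pos)
  qed
  then show ?thesis unfolding curve_points_def proj_plane_eq pt_def by auto
qed

lemma curve_add_cls:
  assumes "sums_to P Q S"
  shows "curve_add R A B (cls P) (cls Q) = cls S"
proof (intro subset_antisym subsetI)
  obtain k where k: "\<And>i. cong3 M (law i A B P Q) (smul (k i) S)"
    using assms unfolding sums_to_def by metis
  have S: "prim S" using assms by (simp add: sums_to_def pt_def)
  have law_k: "cong3 M (mod3 M (law i A B (mod3 M (smul u P)) (mod3 M (smul v Q)))) (smul (u^2 * v^2 * k i) S)" for i u v
  proof -
    have "cong3 M (law i A B (mod3 M (smul u P)) (mod3 M (smul v Q))) (law i A B (smul u P) (smul v Q))"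
      by (intro cong3_law) simp_all
    moreover have "cong3 M (law i A B (smul u P) (smul v Q)) (smul (u^2 * v^2 * k i) S)"
      using cong3_smul[OF k cong_refl, of "u^2 * v^2" i] by (simp add: law_smul smul_smul)
    ultimately show ?thesis using cong3_trans cong3_mod3 by blast
  qed
  {
    fix r assume "r \<in> curve_add R A B (cls P) (cls Q)"
    then obtain u v a b c where r: "r \<in> primitive_triples R"
      "r = lin_comb3 R a (add_law1 R A B (mod3 M (smul u P)) (mod3 M (smul v Q)))
        b (add_law2 R A B (mod3 M (smul u P)) (mod3 M (smul v Q)))
        c (add_law3 R A B (mod3 M (smul u P)) (mod3 M (smul v Q)))"
      unfolding curve_add_def cls_def by blast
    define w where "w = a * (u^2 * v^2 * k 0) + b * (u^2 * v^2 * k 1) + c * (u^2 * v^2 * k 2)"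
    have "r = mod3 M (smul w S)"
      unfolding r(2) lin_comb3_residue_ring[OF M_pos] add_law1_residue_ring[OF M_pos]
        add_law2_residue_ring[OF M_pos] add_law3_residue_ring[OF M_pos] mod3_eq_iff w_def
        lin3_smul[symmetric]
      by (intro cong3_lin3 law_k)
    moreover have "\<not> p dvd w"
      using r(1) prim_smulD calculation by (metis primitive_triples_iff prim_mod3)
    ultimately show "r \<in> cls S" unfolding cls_def by blast
  }
  {
    fix r assume "r \<in> cls S"
    then obtain w where w: "\<not> p dvd w" "r = mod3 M (smul w S)" unfolding cls_def by blast
    obtain i l where l: "\<not> p dvd l" "cong3 M (law i A B P Q) (smul l S)"
      using assms unfolding sums_to_def by blast
    obtain v where v: "[l * v = 1] (mod M)" using inverse_mod[OF l(1)] by blast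
    \<comment> \<open>The index in \<open>sums_to\<close> is unbounded, whereas
      \<open>curve_add\<close> combines three values; index 2 stands for all larger ones.\<close>
    define j where "j = (if i = 0 \<or> i = 1 then i else 2)"
    have ij: "law i = law j" by (simp add: j_def law_def fun_eq_iff)
    \<comment> \<open>With v inverse to l, the coefficient n turns the value of law j into the
      wanted multiple w of S; the other two coefficients will be zero.\<close>
    define n where "n = v * w mod M"
    have n: "n \<in> carrier R" "0 \<in> carrier R" using M_pos by (simp_all add: n_def carrier_residue_ring)
    have "[n * l = w * 1] (mod M)"
    proof -
      have "[n * l = v * w * l] (mod M)" by (simp add: n_def cong_def mod_mult_left_eq)
      moreover have "[w * (l * v) = w * 1] (mod M)" by (intro cong_mult cong_refl v)
      ultimately show ?thesis using cong_trans by (metis mult.assoc mult.commute)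
    qed
    then have "cong3 M (smul n (smul l S)) (smul w S)"
      using cong3_smul[OF cong3_refl] by (simp add: smul_smul)
    moreover have "cong3 M (mod3 M (law j A B (mod3 M P) (mod3 M Q))) (smul l S)"
      using cong3_trans[OF cong3_mod3 cong3_trans[OF cong3_law[OF cong3_mod3 cong3_mod3] l(2)[unfolded ij]]] .
    ultimately have *: "cong3 M (smul n (mod3 M (law j A B (mod3 M P) (mod3 M Q)))) (smul w S)"
      using cong3_trans cong3_smul[OF _ cong_refl] by blast
    define a where "a = (if j = 0 then n else 0)"
    define b where "b = (if j = 1 then n else 0)"
    define c where "c = (if j = 2 then n else 0)"
    have abc: "a \<in> carrier R" "b \<in> carrier R" "c \<in> carrier R" using n by (simp_all add: a_def b_def c_def)
    have "lin3 a (mod3 M (law 0 A B (mod3 M P) (mod3 M Q))) b (mod3 M (law 1 A B (mod3 M P) (mod3 M Q)))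
        c (mod3 M (law 2 A B (mod3 M P) (mod3 M Q))) = smul n (mod3 M (law j A B (mod3 M P) (mod3 M Q)))"
      by (auto simp: lin3_def smul_def a_def b_def c_def j_def case_prod_beta)
    then have "r = lin_comb3 R a (add_law1 R A B (mod3 M P) (mod3 M Q)) b (add_law2 R A B (mod3 M P) (mod3 M Q))
        c (add_law3 R A B (mod3 M P) (mod3 M Q))"
      unfolding w(2) lin_comb3_residue_ring[OF M_pos] add_law1_residue_ring[OF M_pos]
        add_law2_residue_ring[OF M_pos] add_law3_residue_ring[OF M_pos] mod3_eq_iff
      using * cong3_sym by simp
    moreover have "r \<in> primitive_triples R"
      using w S by (simp add: primitive_triples_iff prim_smul)
    ultimately show "r \<in> curve_add R A B (cls P) (cls Q)"
      unfolding curve_add_def using in_cls_self abc by blast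
  }
qed

end

section \<open>The group axioms\<close>

context elliptic_mod
begin

lemma pt_zero: "pt (0, 1, 0)"
  using p_gt_1 by (simp add: pt_def prim_def cubic_def)

lemma pt_neg: "pt (x, y, z) \<Longrightarrow> pt (x, - y, z)"
  by (simp add: pt_def prim_def cubic_def)

text \<open>A single law whose value is a unit multiple of a point identifies the sum;
  commutativity, the neutral element and inverses are obtained in this way.\<close>

lemma cls_sums_to_unique:
  assumes "pt P" "pt Q" "sums_to P Q S" "\<not> p dvd k" "cong3 M (law i A B P Q) (smul k T)" "pt T"
  shows "cls S = cls T"
proof -
  obtain l where l: "cong3 M (law i A B P Q) (smul l S)" using assms(3) by (auto simp: sums_to_def)
  have lk: "cong3 M (smul l S) (smul k T)" using cong3_trans[OF cong3_sym[OF l] assms(5)] .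
  obtain v where v: "[k * v = 1] (mod M)" "\<not> p dvd v" using assms(4) by (rule inverse_mod)
  have "cong3 M (smul (v * l) S) (smul (v * k) T)"
    using cong3_smul[OF lk cong_refl, of v] by (simp add: smul_smul)
  moreover have "cong3 M (smul (v * k) T) T"
    using cong3_smul[OF cong3_refl v(1), of T] by (simp add: mult.commute)
  ultimately have T: "cong3 M T (smul (v * l) S)" using cong3_trans cong3_sym by blast
  moreover have "\<not> p dvd v * l"
    using prim_smulD[of "v * l" S] prim_cong[OF cong3_M_p[OF T]] assms(6) by (auto simp: pt_def)
  ultimately show ?thesis using cls_eq_iff[of S T] assms(3) by (auto simp: sums_to_def pt_def)
qed

abbreviation E where "E \<equiv> curve_group R A B"

lemma carrier_E: "carrier E = cls ` {s. pt s}"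
  by (simp add: curve_group_def curve_points_eq)

lemma one_E: "\<one>\<^bsub>E\<^esub> = cls (0, 1, 0)"
proof -
  have "\<one>\<^bsub>E\<^esub> = proj_point R 0 1 0" by (simp add: curve_group_def residue_ring_def)
  then show ?thesis using p_gt_1 M_pos by (simp add: proj_point_eq_cls prim_def mod3_def)
qed

lemma mult_E: "sums_to P Q S \<Longrightarrow> cls P \<otimes>\<^bsub>E\<^esub> cls Q = cls S"
  by (simp add: curve_group_def curve_add_cls)

lemma sums_to_assoc:
  assumes "pt P" "pt Q" "pt W"
    and "sums_to P Q X" "sums_to X W S" "sums_to Q W Y" "sums_to P Y T"
  shows "cls S = cls T"
proof -
  obtain j a where a: "\<not> p dvd a" "cong3 M (law j A B P Q) (smul a X)" using assms(4) by (auto simp: sums_to_def)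
  obtain i b where b: "\<not> p dvd b" "cong3 M (law i A B X W) (smul b S)" using assms(5) by (auto simp: sums_to_def)
  obtain l c where c: "\<not> p dvd c" "cong3 M (law l A B Q W) (smul c Y)" using assms(6) by (auto simp: sums_to_def)
  obtain k d where d: "\<not> p dvd d" "cong3 M (law k A B P Y) (smul d T)" using assms(7) by (auto simp: sums_to_def)
  have 1: "cong3 M (law i A B (law j A B P Q) W) (smul (a^2 * b) S)"
    using cong3_trans[OF cong3_law[OF a(2) cong3_refl, of i A B W]] cong3_smul[OF b(2) cong_refl, of "a^2"]
      law_smul[of i A B a X 1 W] by (simp add: smul_smul)
  have 2: "cong3 M (law k A B P (law l A B Q W)) (smul (c^2 * d) T)"
    using cong3_trans[OF cong3_law[OF cong3_refl c(2), of k A B P]] cong3_smul[OF d(2) cong_refl, of "c^2"]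
      law_smul[of k A B 1 P c Y] by (simp add: smul_smul)
  have "cong3 M (cross (smul (a^2 * b) S) (smul (c^2 * d) T)) (0, 0, 0)"
    using cong3_trans[OF cong3_sym[OF cong3_cross[OF 1 2]] law_assoc[OF assms(1-3)]] .
  moreover have "coprime (a^2 * b * (c^2 * d)) M"
    unfolding coprime_M using prime a b c d by (simp add: prime_dvd_mult_iff prime_dvd_power_iff)
  ultimately have "cong3 M (cross S T) (0, 0, 0)"
    unfolding cross_smul by (rule cong3_smul_zero_cancel)
  moreover have "prim S" "prim T" using assms(5,7) by (simp_all add: sums_to_def pt_def)
  ultimately show ?thesis using proportional_unit cls_eq_iff by metis
qed

lemma comm_group_E: "comm_group E"
proof (rule comm_groupI)
  fix X Y assume "X \<in> carrier E" "Y \<in> carrier E"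
  then obtain P Q where P: "pt P" "X = cls P" and Q: "pt Q" "Y = cls Q" by (auto simp: carrier_E)
  obtain S where S: "sums_to P Q S" using sums_to_exists[OF P(1) Q(1)] .
  show "X \<otimes>\<^bsub>E\<^esub> Y \<in> carrier E"
    using mult_E[OF S] S P Q by (auto simp: carrier_E sums_to_def)
  obtain T where T: "sums_to Q P T" using sums_to_exists[OF Q(1) P(1)] .
  obtain i k where k: "\<not> p dvd k" "cong3 M (law i A B Q P) (smul k T)" using T by (auto simp: sums_to_def)
  \<comment> \<open>The second law is symmetric; the other two change sign under a swap, which the
    projective class does not see.\<close>
  define \<epsilon> :: int where "\<epsilon> = (if i = 1 then 1 else - 1)"
  have "cong3 M (law i A B P Q) (smul (\<epsilon> * k) T)"
    unfolding law_commute[of i A B P Q] \<epsilon>_def[symmetric] smul_smul[symmetric]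
    using k(2) by (rule cong3_smul) simp
  moreover have "\<not> p dvd \<epsilon> * k" using k(1) by (simp add: \<epsilon>_def)
  ultimately have "cls S = cls T"
    using cls_sums_to_unique[OF P(1) Q(1) S] T by (auto simp: sums_to_def)
  then show "X \<otimes>\<^bsub>E\<^esub> Y = Y \<otimes>\<^bsub>E\<^esub> X" using mult_E[OF S] mult_E[OF T] P Q by simp
next
  show "\<one>\<^bsub>E\<^esub> \<in> carrier E" using pt_zero by (auto simp: carrier_E one_E)
next
  fix X Y Z assume "X \<in> carrier E" "Y \<in> carrier E" "Z \<in> carrier E"
  then obtain P Q W where P: "pt P" "X = cls P" and Q: "pt Q" "Y = cls Q" and W: "pt W" "Z = cls W"
    by (auto simp: carrier_E)
  obtain U where U: "sums_to P Q U" using sums_to_exists[OF P(1) Q(1)] .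
  then have "pt U" by (simp add: sums_to_def)
  then obtain S where S: "sums_to U W S" using sums_to_exists W(1) by blast
  obtain V where V: "sums_to Q W V" using sums_to_exists[OF Q(1) W(1)] .
  then have "pt V" by (simp add: sums_to_def)
  then obtain T where T: "sums_to P V T" using sums_to_exists P(1) by blast
  have "cls S = cls T" using sums_to_assoc[OF P(1) Q(1) W(1) U S V T] .
  then show "X \<otimes>\<^bsub>E\<^esub> Y \<otimes>\<^bsub>E\<^esub> Z = X \<otimes>\<^bsub>E\<^esub> (Y \<otimes>\<^bsub>E\<^esub> Z)"
    by (simp add: P Q W mult_E[OF U] mult_E[OF S] mult_E[OF V] mult_E[OF T])
next
  fix X assume "X \<in> carrier E"
  then obtain x y z where P: "pt (x, y, z)" "X = cls (x, y, z)" by (auto simp: carrier_E)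
  obtain S where S: "sums_to (0, 1, 0) (x, y, z) S" using sums_to_exists[OF pt_zero P(1)] .
  obtain i where i: "prim (law i A B (0, 1, 0) (x, y, z))"
    using law_prim[OF pt_zero P(1)] by blast
  obtain k where k: "law i A B (0, 1, 0) (x, y, z) = smul k (x, y, z)"
    unfolding law_commute[of i A B "(0, 1, 0)"] law_zero_right smul_smul by blast
  then have "\<not> p dvd k" using i prim_smulD by metis
  then have "cls S = X" using cls_sums_to_unique[OF pt_zero P(1) S] k P by (metis cong3_refl)
  then show "\<one>\<^bsub>E\<^esub> \<otimes>\<^bsub>E\<^esub> X = X" using mult_E[OF S] P one_E by simp
  have N: "pt (x, - y, z)" using pt_neg P(1) by blast
  obtain T where T: "sums_to (x, - y, z) (x, y, z) T" using sums_to_exists[OF N P(1)] .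
  obtain j where j: "prim (law j A B (x, - y, z) (x, y, z))"
    using law_prim[OF N P(1)] by blast
  obtain l where l: "law j A B (x, - y, z) (x, y, z) = smul l (0, 1, 0)"
    using law_inverse[of j A B x "- y" z] by auto
  then have "\<not> p dvd l" using j prim_smulD by metis
  then have "cls T = cls (0, 1, 0)" using cls_sums_to_unique[OF N P(1) T] l pt_zero by (metis cong3_refl)
  then show "\<exists>Y\<in>carrier E. Y \<otimes>\<^bsub>E\<^esub> X = \<one>\<^bsub>E\<^esub>"
    using mult_E[OF T] one_E P N by (intro bexI[of _ "cls (x, - y, z)"]) (auto simp: carrier_E)
qed

lemma group_E: "group E"
  using comm_group_E comm_group_def by blast

end

section \<open>Reduction modulo the prime\<close>

lemma poly_second_order:
  fixes f :: "int poly"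
  shows "\<exists>k. poly f (x + h) = poly f x + h * poly (pderiv f) x + h^2 * k"
proof (induction f)
  case 0 then show ?case by simp
next
  case (pCons a f)
  then obtain k where k: "poly f (x + h) = poly f x + h * poly (pderiv f) x + h^2 * k" by blast
  show ?case
  proof
    have "poly (pCons a f) (x + h) = a + (x + h) * poly f (x + h)" by simp
    then show "poly (pCons a f) (x + h) = poly (pCons a f) x + h * poly (pderiv (pCons a f)) x +
        h^2 * (poly (pderiv f) x + x * k + h * k)"
      unfolding k by (simp add: pderiv_pCons algebra_simps power2_eq_square)
  qed
qed

lemma cong_poly: "[x = y] (mod m) \<Longrightarrow> [poly f x = poly f y] (mod m)" for m :: int
  by (induction f) (auto intro: cong_add cong_mult)

lemma hensel_lift:
  fixes p :: int and f :: "int poly"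
  assumes p: "prime p" and "e \<ge> 1" and x0: "p dvd poly f x0" "\<not> p dvd poly (pderiv f) x0"
  obtains x where "[x = x0] (mod p)" "p ^ e dvd poly f x"
proof -
  have "\<exists>x. [x = x0] (mod p) \<and> p ^ e dvd poly f x"
    using \<open>e \<ge> 1\<close>
  proof (induction e rule: nat_induct_at_least)
    case base then show ?case using x0(1) by (intro exI[of _ x0]) simp
  next
    case (Suc n)
    then obtain x c where x: "[x = x0] (mod p)" "poly f x = p ^ n * c" by (metis dvdE)
    have "\<not> p dvd poly (pderiv f) x" using cong_poly[OF x(1)] x0(2) cong_dvd_iff by blast
    then have "coprime (poly (pderiv f) x) p" using p by (metis coprime_commute prime_imp_coprime)
    then obtain v where v: "[poly (pderiv f) x * v = 1] (mod p)" using cong_solve_coprime_int by blast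
    \<comment> \<open>A Newton step. An inverse of the derivative modulo p is enough, since p^n
      already divides the value of f.\<close>
    define h where "h = - (p ^ n * c * v)"
    obtain k where k: "poly f (x + h) = poly f x + h * poly (pderiv f) x + h^2 * k"
      using poly_second_order by blast
    have "p ^ n dvd h" by (simp add: h_def)
    moreover have "p dvd p ^ n" using Suc by (simp add: dvd_power)
    ultimately have ph: "p dvd h" using dvd_trans by blast
    have "p * p ^ n dvd h * h" using mult_dvd_mono[OF ph \<open>p ^ n dvd h\<close>] .
    then have 1: "p ^ Suc n dvd h^2 * k" by (simp add: power2_eq_square)
    have "p dvd 1 - poly (pderiv f) x * v" using v by (simp add: cong_sym_eq cong_iff_dvd_diff dvd_diff_commute)
    then have "p ^ n * p dvd (p ^ n * c) * (1 - poly (pderiv f) x * v)" by (intro mult_dvd_mono) simp_all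
    also have "(p ^ n * c) * (1 - poly (pderiv f) x * v) = poly f x + h * poly (pderiv f) x"
      by (simp add: x h_def algebra_simps)
    finally have "p ^ Suc n dvd poly f (x + h)" unfolding k using 1 by (simp add: mult.commute)
    moreover have "[x + h = x0 + 0] (mod p)" using x(1) ph by (intro cong_add) (simp_all add: cong_0_iff)
    ultimately show ?case by auto
  qed
  then show thesis using that by blast
qed

lemma cong3_law_coeff:
  assumes "[A = A'] (mod m)" "[B = B'] (mod m)"
  shows "cong3 m (law i A B s t) (law i A' B' s t)"
proof -
  obtain x y z a b c where st: "s = (x, y, z)" "t = (a, b, c)" by (cases s; cases t)
  consider "i = 0" | "i = 1" | "i > 1" by linarith
  then show ?thesis
    by cases (simp_all add: cong3_def law_defs st; insert assms;
      intro conjI cong_diff cong_uminus cong_add cong_mult cong_pow cong_refl; simp)+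
qed

text \<open>The theorem reduces the coefficients modulo p, while the locale keeps one pair of
  integers A, B for both moduli; this reconciles the two.\<close>

lemma curve_group_mod:
  assumes "m > 1"
  shows "curve_group (residue_ring m) (A mod m) (B mod m) = curve_group (residue_ring m) A B"
proof -
  have c: "[A mod m = A] (mod m)" "[B mod m = B] (mod m)" by simp_all
  have l: "mod3 m (law i (A mod m) (B mod m) s t) = mod3 m (law i A B s t)" for i s t
    unfolding mod3_eq_iff by (rule cong3_law_coeff[OF c])
  have "[cubic (A mod m) (B mod m) s = cubic A B s] (mod m)" for s
    by (cases s) (simp add: cubic_def; intro cong_diff cong_add cong_mult cong_refl c)
  then have "m dvd cubic (A mod m) (B mod m) s \<longleftrightarrow> m dvd cubic A B s" for s using cong_dvd_iff by blast
  then show ?thesis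
    by (simp add: curve_group_def curve_points_def curve_add_def weierstrass_eq_residue_ring[OF assms] l
      add_law1_residue_ring[OF assms] add_law2_residue_ring[OF assms] add_law3_residue_ring[OF assms]
      fun_eq_iff)
qed

context elliptic_mod
begin

text \<open>The curve over F_p is the case of exponent one of the same theory, so that an integer
  triple can be used unchanged at both levels.\<close>

interpretation F: elliptic_mod p "Suc 0" A B
  by unfold_locales (simp_all add: prime p_odd disc)

abbreviation Ep where "Ep \<equiv> curve_group (residue_ring p) A B"

lemma pt_imp_F_pt: "pt s \<Longrightarrow> F.pt s"
  unfolding pt_def F.pt_def power_Suc0_right using dvd_trans[OF p_dvd_M] by blast

text \<open>Congruences modulo p^e persist modulo p, so the same integer triple is the sum at both
  levels. This is why the reduction is a homomorphism.\<close>

lemma sums_to_imp_F: "sums_to P Q S \<Longrightarrow> F.sums_to P Q S"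
proof -
  have "cong3 (p ^ Suc 0) s t" if "cong3 M s t" for s t using cong3_M_p[OF that] by simp
  moreover assume "sums_to P Q S"
  ultimately show ?thesis unfolding sums_to_def F.sums_to_def using pt_imp_F_pt by blast
qed

lemma reduce_cls:
  assumes "prim s"
  shows "reduce_point p (cls s) = F.cls s"
proof -
  have 1: "(\<lambda>(x, y, z). (x mod p, y mod p, z mod p)) = mod3 p" by (simp add: mod3_def)
  have 2: "mod3 p (mod3 M t) = mod3 p t" for t
    unfolding mod3_eq_iff using cong3_M_p[OF cong3_mod3] .
  have 3: "proj_rel (residue_ring p) `` {mod3 p (smul u s)} = F.cls s" if "\<not> p dvd u" for u
  proof -
    have "F.prim (smul u s)" using assms that by (simp add: prim_smul)
    then have "proj_rel (residue_ring p) `` {mod3 p (smul u s)} = F.cls (smul u s)"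
      using F.proj_rel_image[of "smul u s"] unfolding power_Suc0_right by blast
    also have "\<dots> = F.cls s"
    proof (rule sym, subst F.cls_eq_iff)
      show "F.prim s" by fact
      show "\<exists>v. \<not> p dvd v \<and> cong3 (p ^ Suc 0) (smul u s) (smul v s)" using that cong3_refl by blast
    qed
    finally show ?thesis .
  qed
  then have *: "proj_rel (residue_ring p) `` {mod3 p t} = F.cls s" if t: "t \<in> cls s" for t
  proof -
    obtain u where u: "\<not> p dvd u" "t = mod3 M (smul u s)" using t unfolding cls_def by blast
    show ?thesis unfolding u(2) 2 by (rule 3[OF u(1)])
  qed
  have "reduce_point p (cls s) = (\<Union>t\<in>cls s. proj_rel (residue_ring p) `` {mod3 p t})"
    unfolding reduce_point_def 1 by blast
  also have "\<dots> = F.cls s" using * in_cls_self[of s] by blast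
  finally show ?thesis .
qed

lemma reduce_hom: "reduce_point p \<in> hom E Ep"
proof (rule homI)
  fix X assume "X \<in> carrier E"
  then obtain P where P: "pt P" "X = cls P" by (auto simp: carrier_E)
  then have "reduce_point p X = F.cls P" "F.pt P" using reduce_cls pt_imp_F_pt by (simp_all add: pt_def)
  then show "reduce_point p X \<in> carrier Ep" using F.carrier_E unfolding power_Suc0_right by blast
next
  fix X Y assume "X \<in> carrier E" "Y \<in> carrier E"
  then obtain P Q where P: "pt P" "X = cls P" and Q: "pt Q" "Y = cls Q" by (auto simp: carrier_E)
  obtain S where S: "sums_to P Q S" using sums_to_exists[OF P(1) Q(1)] .
  have "prim S" using S by (simp add: sums_to_def pt_def)
  then show "reduce_point p (X \<otimes>\<^bsub>E\<^esub> Y) = reduce_point p X \<otimes>\<^bsub>Ep\<^esub> reduce_point p Y"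
    using F.mult_E[OF sums_to_imp_F[OF S]] P Q mult_E[OF S] reduce_cls
    unfolding power_Suc0_right pt_def by metis
qed

lemma group_Ep: "group Ep"
  using F.group_E by simp

lemma reduce_group_hom: "group_hom E Ep (reduce_point p)"
  by (simp add: group_hom_def group_hom_axioms_def group_E group_Ep reduce_hom)

text \<open>Smoothness modulo p: at an affine point 2 y or 3 x^2 + A is prime to p, so one
  coordinate can be lifted by \<open>hensel_lift\<close> while the other is kept fixed. The neutral
  element lifts to itself.\<close>

lemma reduce_surj: "reduce_point p ` carrier E = carrier Ep"
proof (intro subset_antisym subsetI)
  fix X assume "X \<in> reduce_point p ` carrier E"
  then show "X \<in> carrier Ep" using reduce_hom by (auto simp: hom_def)
next
  fix X assume "X \<in> carrier Ep"
  then obtain P where P: "F.pt P" "X = F.cls P" using F.carrier_E by auto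
  have "\<exists>s. pt s \<and> F.cls P = F.cls s"
  proof (rule F.pt_mod_p[OF P(1)])
    fix u assume "\<not> p dvd u" "cong3 p (0, 1, 0) (smul u P)"
    then show ?thesis using pt_zero P(1) F.cls_eq_iff[of P "(0, 1, 0)"] by (auto simp: F.pt_def)
  next
    fix u x y assume u: "\<not> p dvd u" "cong3 p (x, y, 1) (smul u P)"
      and eq: "p dvd y^2 - (x^3 + A * x + B)"
    obtain x' y' where xy: "[x' = x] (mod p)" "[y' = y] (mod p)" "M dvd y'^2 - (x'^3 + A * x' + B)"
    proof (cases "p dvd y")
      case False
      let ?f = "[:- (x^3 + A * x + B), 0, 1:]"
      have f: "poly ?f y = y^2 - (x^3 + A * x + B)" for y
        by (simp add: power2_eq_square)
      have "p dvd poly ?f y" unfolding f by (rule eq)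
      moreover have "\<not> p dvd poly (pderiv ?f) y"
        using False not_p_dvd_2 prime by (simp add: pderiv_pCons prime_dvd_mult_iff flip: mult_2)
      ultimately obtain y' where "[y' = y] (mod p)" "M dvd poly ?f y'" using hensel_lift[OF prime e] by blast
      then show thesis using that[of x y'] unfolding f by (simp only: cong_refl)
    next
      case True
      let ?f = "[:B - y^2, A, 0, 1:]"
      have f: "poly ?f x = - (y^2 - (x^3 + A * x + B))" for x
        by (simp add: power2_eq_square power3_eq_cube algebra_simps)
      have "p dvd poly ?f x" unfolding f using eq by (simp only: dvd_minus_iff)
      moreover have "\<not> p dvd poly (pderiv ?f) x"
      proof -
        have "p dvd y^2 - (y^2 - (x^3 + A * x + B))"
          using True by (intro dvd_diff[OF _ eq]) (simp add: power2_eq_square)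
        then have "p dvd x^3 + A * x + B" by (simp add: algebra_simps)
        then have "\<not> p dvd 3 * x^2 + A" by (rule simple_root)
        moreover have "poly (pderiv ?f) x = 3 * x^2 + A"
          by (simp add: pderiv_pCons power2_eq_square algebra_simps)
        ultimately show ?thesis by simp
      qed
      ultimately obtain x' where "[x' = x] (mod p)" "M dvd poly ?f x'" using hensel_lift[OF prime e] by blast
      then show thesis using that[of x' y] unfolding f by (simp only: dvd_minus_iff cong_refl)
    qed
    have "pt (x', y', 1)" using xy(3) p_gt_1 by (simp add: pt_def prim_def cubic_def)
    moreover have "cong3 p (x', y', 1) (x, y, 1)" using xy(1,2) by (simp add: cong3_def)
    then have "cong3 p (x', y', 1) (smul u P)" using u(2) by (rule cong3_trans)
    then have "F.cls P = F.cls (x', y', 1)"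
      using u(1) P(1) F.cls_eq_iff[of P "(x', y', 1)"] by (auto simp: F.pt_def)
    ultimately show ?thesis by blast
  qed
  then obtain s where s: "pt s" "F.cls P = F.cls s" by blast
  then have "X = reduce_point p (cls s)" using P(2) reduce_cls by (simp add: pt_def)
  then show "X \<in> reduce_point p ` carrier E" using s(1) by (auto simp: carrier_E)
qed

section \<open>The kernel of the reduction\<close>

definition inf_pt :: "int \<Rightarrow> int \<Rightarrow> bool"
  where "inf_pt X Z \<longleftrightarrow> pt (X, 1, Z) \<and> p dvd X \<and> p dvd Z"

lemma one_Ep: "\<one>\<^bsub>Ep\<^esub> = F.cls (0, 1, 0)"
  using F.one_E by simp

lemma kernel_eq: "kernel E Ep (reduce_point p) = {cls (X, 1, Z) | X Z. inf_pt X Z}"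
proof (intro subset_antisym subsetI)
  fix T assume "T \<in> kernel E Ep (reduce_point p)"
  then obtain s where s: "pt s" "T = cls s" "F.cls s = F.cls (0, 1, 0)"
    using reduce_cls by (auto simp: kernel_def carrier_E pt_def one_Ep)
  obtain x y z where xyz: "s = (x, y, z)" by (cases s)
  have "F.prim (0, 1, 0)" using F.pt_zero by (simp add: F.pt_def)
  then obtain u where u: "cong3 p (x, y, z) (smul u (0, 1, 0))" "\<not> p dvd u"
    using s(3) F.cls_eq_iff[of "(0, 1, 0)" s] xyz by auto
  then have d: "p dvd x" "p dvd z" "\<not> p dvd y"
    by (auto simp: cong3_def smul_def cong_0_iff cong_dvd_iff)
  obtain v where v: "[y * v = 1] (mod M)" "\<not> p dvd v" using d(3) by (rule inverse_mod)
  have c: "cong3 M (v * x, 1, v * z) (smul v s)"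
    using v(1) by (simp add: xyz smul_def cong3_def cong_sym mult.commute)
  then have "pt (v * x, 1, v * z)" using pt_cong pt_smul v(2) s(1) by blast
  then have "inf_pt (v * x) (v * z)" using d by (simp add: inf_pt_def)
  moreover have "T = cls (v * x, 1, v * z)" using cls_eq_iff[of s] c v(2) s by (auto simp: pt_def)
  ultimately show "T \<in> {cls (X, 1, Z) | X Z. inf_pt X Z}" by blast
next
  fix T assume "T \<in> {cls (X, 1, Z) | X Z. inf_pt X Z}"
  then obtain X Z where T: "T = cls (X, 1, Z)" "inf_pt X Z" by blast
  then have p: "pt (X, 1, Z)" by (simp add: inf_pt_def)
  have "cong3 p (X, 1, Z) (smul 1 (0, 1, 0))" using T(2) by (simp add: inf_pt_def cong3_def cong_0_iff)
  then have "F.cls (0, 1, 0) = F.cls (X, 1, Z)"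
    using F.cls_eq_iff[of "(0, 1, 0)" "(X, 1, Z)"] F.pt_zero p_gt_1 unfolding F.pt_def
    by (metis power_Suc0_right zdvd1_eq abs_of_nonneg less_le zero_le_one order_trans not_less_iff_gr_or_eq)
  then show "T \<in> kernel E Ep (reduce_point p)"
    using p T reduce_cls[of "(X, 1, Z)"] by (auto simp: kernel_def one_Ep carrier_E pt_def)
qed

text \<open>The curve equation reads Z (1 - A X Z - B Z^2) = X^3, where the second factor is a unit.
  It holds only modulo p^e, whence the bound on k.\<close>

lemma inf_pt_Z:
  assumes "inf_pt X Z" "k \<le> e" "p ^ k dvd X"
  shows "p ^ k dvd Z"
proof -
  have M: "p ^ k dvd M" using assms(2) by (rule le_imp_power_dvd)
  have "M dvd Z - (X^3 + A * X * Z^2 + B * Z^3)" using assms(1) by (simp add: inf_pt_def pt_def cubic_def)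
  then have "p ^ k dvd Z - (X^3 + A * X * Z^2 + B * Z^3)" using M dvd_trans by blast
  moreover have "p ^ k dvd X^3" using assms(3) by (simp add: power3_eq_cube)
  ultimately have "p ^ k dvd (Z - (X^3 + A * X * Z^2 + B * Z^3)) + X^3" by (rule dvd_add)
  also have "\<dots> = Z * (1 - A * X * Z - B * Z^2)" by (simp add: algebra_simps power2_eq_square power3_eq_cube)
  finally have 1: "p ^ k dvd Z * (1 - A * X * Z - B * Z^2)" .
  have "\<not> p dvd 1 - A * X * Z - B * Z^2"
  proof
    assume "p dvd 1 - A * X * Z - B * Z^2"
    then have "p dvd (1 - A * X * Z - B * Z^2) + (A * X * Z + B * Z^2)"
      using assms(1) by (intro dvd_add) (simp_all add: inf_pt_def power2_eq_square)
    then show False using p_gt_1 by simp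
  qed
  then have "coprime (p ^ k) (1 - A * X * Z - B * Z^2)"
    using prime by (simp add: prime_imp_coprime)
  then show ?thesis using 1 by (simp add: coprime_dvd_mult_left_iff)
qed

text \<open>The second law is taken because its value for the neutral element added to itself is (0,
  1, 0), whereas the other two laws vanish there. With q = p^k it yields U = X + X' modulo q^3 and V
  = 1 modulo q^2, while q divides U and W; so division by V changes U only by multiples of q^3, as
  far as p^e permits. The precision k + 2 is at most 3 k, and it is what control of the exact
  valuation of a p-th multiple requires.\<close>

lemma inf_pt_add:
  assumes "inf_pt X Z" "inf_pt X' Z'" "k \<ge> 1" "k \<le> e" "p ^ k dvd X" "p ^ k dvd X'"
  obtains X3 Z3 where "inf_pt X3 Z3" "cls (X, 1, Z) \<otimes>\<^bsub>E\<^esub> cls (X', 1, Z') = cls (X3, 1, Z3)"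
    "p ^ k dvd X3" "\<And>j. j \<le> e \<Longrightarrow> j \<le> k + 2 \<Longrightarrow> [X3 = X + X'] (mod p ^ j)"
proof -
  obtain a where a: "X = p ^ k * a" using assms(5) by blast
  obtain a' where a': "X' = p ^ k * a'" using assms(6) by blast
  obtain b where b: "Z = p ^ k * b" using inf_pt_Z[OF assms(1,4,5)] by blast
  obtain b' where b': "Z' = p ^ k * b'" using inf_pt_Z[OF assms(2,4,6)] by blast
  define q where "q = p ^ k"
  have p: "pt (X, 1, Z)" "pt (X', 1, Z')" using assms(1,2) by (simp_all add: inf_pt_def)
  define U where "U = fst (law 1 A B (X, 1, Z) (X', 1, Z'))"
  define V where "V = fst (snd (law 1 A B (X, 1, Z) (X', 1, Z')))"
  define W where "W = snd (snd (law 1 A B (X, 1, Z) (X', 1, Z')))"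
  have L: "law 1 A B (X, 1, Z) (X', 1, Z') = (U, V, W)" by (simp add: U_def V_def W_def)
  have U: "q^3 dvd U - (X + X')"
  proof -
    have "U - (X + X') = q^3 * (- A * (a * a') * (b + b') - A * (a + a') * (a * b' + a' * b)
      - 3 * B * (a + a') * (b * b') - 3 * B * (a * b' + a' * b) * (b + b') + A^2 * (b + b') * (b * b'))"
      unfolding U_def a a' b b' q_def[symmetric]
      by (simp add: law_defs) Groebner_Basis.algebra
    then show ?thesis by (metis dvd_triv_left)
  qed
  have V: "q^2 dvd V - 1"
  proof -
    have "V - 1 = q^2 * (q^2 * (3 * A * (a * a')^2 + 9 * B * (a * a') * (a * b' + a' * b)
      - A^2 * (a * b') * (a * b' + 2 * (a' * b)) - A^2 * (a' * b) * (2 * (a * b') + a' * b)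
      - 3 * A * B * (b * b') * (a * b' + a' * b) - (A^3 + 9 * B^2) * (b * b')^2))"
      unfolding V_def a a' b b' q_def[symmetric]
      by (simp add: law_defs) Groebner_Basis.algebra
    then show ?thesis by (metis dvd_triv_left)
  qed
  have W: "q dvd W"
  proof -
    have "W = q * (b + b' + 3 * (X * X') * (a + a') + A * (a + a') * (Z * Z')
      + A * (X * b' + X' * b) * (Z + Z') + 3 * B * (b + b') * (Z * Z'))"
      unfolding W_def a a' b b' q_def[symmetric]
      by (simp add: law_defs) Groebner_Basis.algebra
    then show ?thesis by simp
  qed
  have pq: "p dvd q" using assms(3) by (simp add: q_def dvd_power)
  have "q dvd U - (X + X') + (X + X')"
    using U assms(5,6) by (intro dvd_add) (auto simp: q_def power3_eq_cube intro: dvd_trans dvd_mult_left)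
  then have qU: "q dvd U" by simp
  have "p dvd V - 1" using V pq by (metis dvd_trans dvd_power pos2)
  have nV: "\<not> p dvd V"
  proof
    assume "p dvd V"
    then have "p dvd V - (V - 1)" using \<open>p dvd V - 1\<close> by (rule dvd_diff)
    then show False using p_gt_1 by simp
  qed
  then obtain w where w: "[V * w = 1] (mod M)" "\<not> p dvd w" by (rule inverse_mod)
  have "prim (U, V, W)" using nV by (simp add: prim_def)
  then have ptL: "pt (U, V, W)" using law_cubic[OF p p(1), of 1] unfolding L pt_def by blast
  have c: "cong3 M (w * U, 1, w * W) (smul w (U, V, W))"
    using w(1) by (simp add: smul_def cong3_def cong_sym mult.commute)
  have ptS: "pt (w * U, 1, w * W)" using pt_cong[OF c] pt_smul w(2) ptL by blast
  have "cls (U, V, W) = cls (w * U, 1, w * W)" using cls_eq_iff ptL c w(2) by (auto simp: pt_def)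
  moreover obtain S where S: "sums_to (X, 1, Z) (X', 1, Z') S" using sums_to_exists[OF p] .
  moreover have "cls S = cls (U, V, W)"
    using p_gt_1 by (intro cls_sums_to_unique[OF p S _ _ ptL, of 1 1]) (simp_all add: L[simplified])
  ultimately have sum: "cls (X, 1, Z) \<otimes>\<^bsub>E\<^esub> cls (X', 1, Z') = cls (w * U, 1, w * W)"
    using mult_E[OF S] by simp
  show thesis
  proof (rule that[OF _ sum])
    show "inf_pt (w * U) (w * W)" using ptS qU W pq dvd_trans by (auto simp: inf_pt_def)
    show "p ^ k dvd w * U" using qU by (simp add: q_def)
    fix j assume j: "j \<le> e" "j \<le> k + 2"
    have "p ^ j dvd q^3"
      unfolding q_def power_mult[symmetric] using j assms(3) by (intro le_imp_power_dvd) simp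
    then have 1: "p ^ j dvd U - (X + X')" using U dvd_trans by blast
    \<comment> \<open>Here j - k is at most 2, hence at most 2 k, and it is truncated to 0 for j
      below k. In either case q times this power is divisible by p^j.\<close>
    have "p ^ (j - k) dvd q^2"
      unfolding q_def power_mult[symmetric] using j assms(3) by (intro le_imp_power_dvd) simp
    then have "p ^ (j - k) dvd w * (V - 1)" using V dvd_trans by (metis dvd_mult)
    moreover have "p ^ (j - k) dvd M" using j by (intro le_imp_power_dvd) simp
    then have "p ^ (j - k) dvd V * w - 1" using w(1) dvd_trans by (auto simp: cong_iff_dvd_diff)
    ultimately have "p ^ (j - k) dvd (V * w - 1) - w * (V - 1)" using dvd_diff by blast
    then have "p ^ (j - k) dvd w - 1" by (simp add: algebra_simps)
    then have "q * p ^ (j - k) dvd U * (w - 1)" using qU by (rule mult_dvd_mono[rotated])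
    moreover have "p ^ j dvd q * p ^ (j - k)" unfolding q_def power_add[symmetric] by (intro le_imp_power_dvd) simp
    ultimately have "p ^ j dvd U * (w - 1)" using dvd_trans by blast
    then have "p ^ j dvd U * (w - 1) + (U - (X + X'))" using 1 by (rule dvd_add)
    then show "[w * U = X + X'] (mod p ^ j)" by (simp add: cong_iff_dvd_diff algebra_simps)
  qed
qed

lemma inf_pt_zero: "inf_pt 0 0"
  using pt_zero by (simp add: inf_pt_def)

lemma inf_pt_multiple:
  fixes n :: nat
  assumes "inf_pt X Z" "k \<ge> 1" "k \<le> e" "p ^ k dvd X"
  obtains X' Z' where "inf_pt X' Z'" "cls (X, 1, Z) [^]\<^bsub>E\<^esub> n = cls (X', 1, Z')" "p ^ k dvd X'"
    "\<And>j. j \<le> e \<Longrightarrow> j \<le> k + 2 \<Longrightarrow> [X' = int n * X] (mod p ^ j)"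
proof -
  interpret group E by (rule group_E)
  have "\<exists>X' Z'. inf_pt X' Z' \<and> cls (X, 1, Z) [^]\<^bsub>E\<^esub> n = cls (X', 1, Z') \<and> p ^ k dvd X' \<and>
    (\<forall>j. j \<le> e \<longrightarrow> j \<le> k + 2 \<longrightarrow> [X' = int n * X] (mod p ^ j))"
  proof (induction n)
    case 0
    then show ?case using inf_pt_zero one_E by (intro exI[of _ 0]) simp
  next
    case (Suc n)
    then obtain X' Z' where n: "inf_pt X' Z'" "cls (X, 1, Z) [^]\<^bsub>E\<^esub> n = cls (X', 1, Z')" "p ^ k dvd X'"
      "\<And>j. j \<le> e \<Longrightarrow> j \<le> k + 2 \<Longrightarrow> [X' = int n * X] (mod p ^ j)" by blast
    obtain X3 Z3 where s: "inf_pt X3 Z3" "cls (X', 1, Z') \<otimes>\<^bsub>E\<^esub> cls (X, 1, Z) = cls (X3, 1, Z3)"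
      "p ^ k dvd X3" "\<And>j. j \<le> e \<Longrightarrow> j \<le> k + 2 \<Longrightarrow> [X3 = X' + X] (mod p ^ j)"
      using inf_pt_add[OF n(1) assms(1-3) n(3) assms(4)] by metis
    have "[X3 = int (Suc n) * X] (mod p ^ j)" if "j \<le> e" "j \<le> k + 2" for j
      using cong_trans[OF s(4)[OF that] cong_add[OF n(4)[OF that] cong_refl, of X]]
      by (simp add: algebra_simps)
    then show ?case using s(1,2,3) n(2) by (intro exI[of _ X3] exI[of _ Z3]) simp
  qed
  then show thesis using that by blast
qed

text \<open>With X = p and Y = 1 the curve equation becomes a polynomial in Z that has the root 0
  modulo p, with derivative 1 there.\<close>

lemma inf_pt_exists: obtains Z where "inf_pt p Z"
proof -
  let ?f = "[:- (p^3), 1, - (A * p), - B:]"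
  have "p dvd poly ?f 0" by (simp add: power3_eq_cube)
  moreover have "\<not> p dvd poly (pderiv ?f) 0" using p_gt_1 by (simp add: pderiv_pCons)
  ultimately obtain Z where Z: "[Z = 0] (mod p)" "M dvd poly ?f Z" using hensel_lift[OF prime e] by blast
  have f: "poly ?f Z = Z - (p^3 + A * p * Z^2 + B * Z^3)"
    by (simp add: power2_eq_square power3_eq_cube algebra_simps)
  then have "inf_pt p Z" using Z(1) Z(2)[unfolded f] p_gt_1 by (simp add: inf_pt_def pt_def prim_def cubic_def cong_0_iff)
  then show thesis by (rule that)
qed

text \<open>Passing to the p-th multiple raises the valuation of X by exactly one, which is read off
  modulo p^(k+2). The guard \<open>k < e\<close> in the last clause reflects that X is known only
  modulo p^e: for k = e it is the zero residue.\<close>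

lemma inf_pt_generator_power:
  assumes "inf_pt p Z" "k \<ge> 1" "k \<le> e"
  obtains X' Z' where "inf_pt X' Z'" "cls (p, 1, Z) [^]\<^bsub>E\<^esub> (nat p ^ (k - 1)) = cls (X', 1, Z')"
    "p ^ k dvd X'" "k < e \<Longrightarrow> \<not> p ^ Suc k dvd X'"
proof -
  interpret group E by (rule group_E)
  have G: "cls (p, 1, Z) \<in> carrier E" using assms(1) by (auto simp: carrier_E inf_pt_def)
  have "k \<le> e \<longrightarrow> (\<exists>X' Z'. inf_pt X' Z' \<and> cls (p, 1, Z) [^]\<^bsub>E\<^esub> (nat p ^ (k - 1)) = cls (X', 1, Z') \<and>
    p ^ k dvd X' \<and> (k < e \<longrightarrow> \<not> p ^ Suc k dvd X'))"
    using assms(2)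
  proof (induction k rule: nat_induct_at_least)
    case base
    have "\<not> p ^ Suc 1 dvd p" using p_gt_1 by (simp add: zdvd_not_zless)
    then show ?case using assms(1) G by (intro impI exI[of _ p] exI[of _ Z]) simp
  next
    case (Suc k)
    show ?case
    proof
      assume k: "Suc k \<le> e"
      then obtain X Y where X: "inf_pt X Y" "cls (p, 1, Z) [^]\<^bsub>E\<^esub> (nat p ^ (k - 1)) = cls (X, 1, Y)"
        "p ^ k dvd X" "\<not> p ^ Suc k dvd X" using Suc by auto
      obtain X' Y' where X': "inf_pt X' Y'" "cls (X, 1, Y) [^]\<^bsub>E\<^esub> nat p = cls (X', 1, Y')"
        "\<And>j. j \<le> e \<Longrightarrow> j \<le> k + 2 \<Longrightarrow> [X' = int (nat p) * X] (mod p ^ j)"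
        using inf_pt_multiple[OF X(1) Suc(1) _ X(3), of "nat p"] k by (metis Suc_leD)
      have pp: "int (nat p) = p" using p_gt_1 by simp
      have "nat p ^ (Suc k - 1) = nat p ^ (k - 1) * nat p"
        using Suc(1) by (metis One_nat_def diff_Suc_1 mult.commute not_one_le_zero power_eq_if)
      then have "cls (p, 1, Z) [^]\<^bsub>E\<^esub> (nat p ^ (Suc k - 1)) = cls (X', 1, Y')"
        using nat_pow_pow[OF G] X(2) X'(2) by metis
      moreover have "p ^ Suc k dvd X'"
      proof -
        have "p ^ Suc k dvd p * X" using X(3) by simp
        then show ?thesis using X'(3)[of "Suc k"] k pp cong_dvd_iff by force
      qed
      moreover have "\<not> p ^ Suc (Suc k) dvd X'" if "Suc k < e"
      proof
        assume "p ^ Suc (Suc k) dvd X'"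
        then have "p ^ Suc (Suc k) dvd p * X"
          using X'(3)[of "Suc (Suc k)"] that pp cong_dvd_iff by force
        then show False using X(4) p_gt_1 by simp
      qed
      ultimately show "\<exists>X' Z'. inf_pt X' Z' \<and> cls (p, 1, Z) [^]\<^bsub>E\<^esub> (nat p ^ (Suc k - 1)) = cls (X', 1, Z') \<and>
        p ^ Suc k dvd X' \<and> (Suc k < e \<longrightarrow> \<not> p ^ Suc (Suc k) dvd X')" using X'(1) by blast
    qed
  qed
  then show thesis using that assms(3) by blast
qed

text \<open>The induction descends from k = e, where both outer coordinates vanish modulo p^e and
  the point is neutral.\<close>

lemma inf_pt_in_generate:
  assumes "inf_pt p Z" "k \<ge> 1" "k \<le> e" "inf_pt X Y" "p ^ k dvd X"
  shows "cls (X, 1, Y) \<in> generate E {cls (p, 1, Z)}"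
  using assms(3,2,4,5)
proof (induction k arbitrary: X Y rule: inc_induct)
  case base
  then have "M dvd X" "M dvd Y" using inf_pt_Z by blast+
  then have "cong3 M (X, 1, Y) (smul 1 (0, 1, 0))" by (simp add: cong3_def cong_0_iff)
  moreover have "prim (0, 1, 0)" using pt_zero by (simp add: pt_def)
  moreover have "\<not> p dvd 1" using p_gt_1 by simp
  ultimately have "cls (0, 1, 0) = cls (X, 1, Y)" using cls_eq_iff by blast
  then show ?case using generate.one[of E] one_E by simp
next
  case (step k)
  interpret group E by (rule group_E)
  have G: "cls (p, 1, Z) \<in> carrier E" using assms(1) by (auto simp: carrier_E inf_pt_def)
  have gen: "subgroup (generate E {cls (p, 1, Z)}) E" using G by (intro generate_is_subgroup) simp
  obtain X1 Y1 where 1: "inf_pt X1 Y1" "cls (p, 1, Z) [^]\<^bsub>E\<^esub> (nat p ^ (k - 1)) = cls (X1, 1, Y1)"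
    "p ^ k dvd X1" "\<not> p ^ Suc k dvd X1"
    using inf_pt_generator_power[OF assms(1) step.prems(1)] step.hyps by (metis less_imp_le)
  obtain a where a: "X = p ^ k * a" using step.prems by blast
  obtain b where b: "X1 = p ^ k * b" using 1 by blast
  have "\<not> p dvd b" using 1(4) p_gt_1 by (auto simp: b)
  then have "coprime b p" using prime by (metis coprime_commute prime_imp_coprime)
  then obtain v where v: "[b * v = 1] (mod p)" using cong_solve_coprime_int by blast
  \<comment> \<open>This is - a / b modulo p as a natural number: adding the n-th multiple of the
    second point removes the digit of X at p^k.\<close>
  define n where "n = nat ((- a * v) mod p)"
  have n: "int n = (- a * v) mod p" using p_gt_1 by (simp add: n_def)
  have "[a + int n * b = a + (- a * v) * b] (mod p)"
    unfolding n by (intro cong_add cong_mult cong_refl) simp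
  also have "a + (- a * v) * b = a + (- a) * (b * v)" by simp
  also have "[\<dots> = a + (- a) * 1] (mod p)" by (intro cong_add cong_mult cong_refl v)
  finally have "p dvd a + int n * b" by (simp add: cong_0_iff)
  then have "p ^ k * p dvd p ^ k * (a + int n * b)" by simp
  then have d: "p ^ Suc k dvd X + int n * X1" by (simp add: a b algebra_simps)
  obtain X2 Y2 where 2: "inf_pt X2 Y2" "cls (X1, 1, Y1) [^]\<^bsub>E\<^esub> n = cls (X2, 1, Y2)" "p ^ k dvd X2"
    "\<And>j. j \<le> e \<Longrightarrow> j \<le> k + 2 \<Longrightarrow> [X2 = int n * X1] (mod p ^ j)"
    using inf_pt_multiple[OF 1(1) step.prems(1) _ 1(3), of n] step.hyps by (metis less_imp_le)
  obtain X3 Y3 where 3: "inf_pt X3 Y3" "cls (X, 1, Y) \<otimes>\<^bsub>E\<^esub> cls (X2, 1, Y2) = cls (X3, 1, Y3)"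
    "\<And>j. j \<le> e \<Longrightarrow> j \<le> k + 2 \<Longrightarrow> [X3 = X + X2] (mod p ^ j)"
    using inf_pt_add[OF step.prems(2) 2(1) step.prems(1) _ step.prems(3) 2(3)] step.hyps by (metis less_imp_le)
  have "[X3 = X + int n * X1] (mod p ^ Suc k)"
    using step.hyps by (intro cong_trans[OF 3(3) cong_add[OF cong_refl 2(4)]]) simp_all
  then have "p ^ Suc k dvd X3" using d cong_dvd_iff by blast
  then have S: "cls (X3, 1, Y3) \<in> generate E {cls (p, 1, Z)}" using step.IH 3(1) by simp
  have "cls (p, 1, Z) \<in> generate E {cls (p, 1, Z)}" by (intro generate.incl) simp
  then have T: "cls (X2, 1, Y2) \<in> generate E {cls (p, 1, Z)}"
    using 1(2) 2(2) subgroup_int_pow_closed[OF gen] int_pow_int by metis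
  have X: "cls (X, 1, Y) \<in> carrier E" "cls (X2, 1, Y2) \<in> carrier E"
    using step.prems 2(1) by (auto simp: carrier_E inf_pt_def)
  then have "cls (X, 1, Y) = cls (X3, 1, Y3) \<otimes>\<^bsub>E\<^esub> inv\<^bsub>E\<^esub> cls (X2, 1, Y2)"
    unfolding 3(2)[symmetric] by (simp add: m_assoc)
  also have "\<dots> \<in> generate E {cls (p, 1, Z)}"
    using subgroup.m_closed[OF gen S subgroup.m_inv_closed[OF gen T]] .
  finally show ?case .
qed

lemma kernel_eq_generate:
  assumes "inf_pt p Z"
  shows "kernel E Ep (reduce_point p) = generate E {cls (p, 1, Z)}"
proof
  interpret group_hom E Ep "reduce_point p" by (rule reduce_group_hom)
  show "kernel E Ep (reduce_point p) \<subseteq> generate E {cls (p, 1, Z)}"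
    unfolding kernel_eq using inf_pt_in_generate[OF assms, of 1] e by (auto simp: inf_pt_def)
  have "cls (p, 1, Z) \<in> kernel E Ep (reduce_point p)" unfolding kernel_eq using assms by blast
  then show "generate E {cls (p, 1, Z)} \<subseteq> kernel E Ep (reduce_point p)"
    by (intro G.generate_subgroup_incl subgroup_kernel) simp
qed

text \<open>The infinity polynomial provides only some x for the point (p : 1 : Z). Comparison of
  the middle coordinates makes the scaling factor 1 modulo p^e, so x can only be p modulo
  p^e.\<close>

lemma infinity_point_p:
  assumes "infinity_polynomial p e A B f" and Z: "inf_pt p Z"
  shows "infinity_point p e f (p mod M) = cls (p, 1, Z)"
proof -
  have pt: "pt (p, 1, Z)" and pZ: "p dvd Z" using Z by (simp_all add: inf_pt_def)
  \<comment> \<open>The third coordinate of every representative is divisible by p, so it is never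
    1.\<close>
  have "cls (p, 1, Z) \<noteq> proj_point R x y \<one>\<^bsub>R\<^esub>" if xy: "x \<in> carrier R" "y \<in> carrier R" for x y
  proof
    assume eq: "cls (p, 1, Z) = proj_point R x y \<one>\<^bsub>R\<^esub>"
    have "mod3 M (x, y, 1) = (x, y, 1)"
      using xy M_pos by (intro mod3_carrier_id) (simp_all add: carrier_residue_ring)
    moreover have "prim (x, y, 1)" using p_gt_1 by (simp add: prim_def)
    ultimately have "cls (p, 1, Z) = cls (x, y, 1)"
      using eq proj_point_eq_cls by (simp add: residue_ring_def)
    then obtain u where "cong3 M (x, y, 1) (smul u (p, 1, Z))" using cls_eq_iff pt by (auto simp: pt_def)
    then have "[1 = u * Z] (mod p)" using cong3_M_p by (auto simp: cong3_def smul_def)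
    then have "p dvd 1" using pZ cong_dvd_iff by (metis dvd_mult)
    then show False using p_gt_1 by simp
  qed
  then have "cls (p, 1, Z) \<in> points_at_infinity R A B"
    using pt by (auto simp: points_at_infinity_def curve_points_eq)
  then obtain x where x: "x \<in> cgenideal R (p mod M)" "cls (p, 1, Z) = infinity_point p e f x"
    using assms(1) by (auto simp: infinity_polynomial_def)
  have xc: "x \<in> carrier R" using x(1) M_pos
    by (auto simp: cgenideal_def residue_ring_def)
  have "mod3 M (x, 1, poly f x mod M) = (x, 1, poly f x mod M)"
    using xc M_pos by (intro mod3_carrier_id) (simp_all add: carrier_residue_ring)
  moreover have "prim (x, 1, poly f x mod M)" using p_gt_1 by (simp add: prim_def)
  ultimately have "cls (p, 1, Z) = cls (x, 1, poly f x mod M)"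
    using x(2) proj_point_eq_cls by (simp add: infinity_point_def)
  then obtain u where "cong3 M (x, 1, poly f x mod M) (smul u (p, 1, Z))"
    using cls_eq_iff pt by (auto simp: pt_def)
  then have "[x = u * p] (mod M)" "[1 = u] (mod M)" by (auto simp: cong3_def smul_def)
  then have "[x = 1 * p] (mod M)" using cong_trans[OF _ cong_mult[OF cong_sym cong_refl]] by blast
  then have "x = p mod M" using xc by (simp add: cong_def carrier_residue_ring[OF M_pos])
  then show ?thesis using x(2) by simp
qed

end

theorem theorem3p7:
  fixes p A B :: int and e :: nat and f :: "int poly"
  assumes "prime p" and "p \<noteq> 2" and "e \<ge> 1"
    and "A \<in> carrier (residue_ring (p ^ e))" and "B \<in> carrier (residue_ring (p ^ e))"
    and "weierstrass_disc (residue_ring (p ^ e)) A B \<in> Units (residue_ring (p ^ e))"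
    and "infinity_polynomial p e A B f"
  defines "E \<equiv> curve_group (residue_ring (p ^ e)) A B"
    and "Ep \<equiv> curve_group (residue_ring p) (A mod p) (B mod p)"
    and "G \<equiv> infinity_point p e f (p mod p ^ e)"
  shows "short_exact_sequence Ep E (subgroup_generated E {G}) (reduce_point p) (\<lambda>P. P)
    \<and> G \<in> carrier E
    \<and> kernel E Ep (reduce_point p) = generate E {G}"
proof -
  have "\<not> p dvd 4 * A^3 + 27 * B^2"
  proof -
    interpret weierstrass_mod p e A B using assms by unfold_locales
    let ?D = "weierstrass_disc (residue_ring (p ^ e)) A B"
    have "\<not> p dvd ?D"
      using assms(6) unfolding Units_residue_ring[OF M_pos] coprime_M by blast
    moreover have "[?D = - (4 * A^3 + 27 * B^2)] (mod p)"
      using weierstrass_disc_residue_ring[OF M_pos] p_dvd_M by (rule cong_dvd_modulus)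
    ultimately show ?thesis using cong_dvd_iff dvd_minus_iff by blast
  qed
  then interpret elliptic_mod p e A B using assms by unfold_locales
  have Ep: "Ep = curve_group (residue_ring p) A B" unfolding Ep_def by (rule curve_group_mod[OF p_gt_1])
  obtain Z where Z: "inf_pt p Z" by (rule inf_pt_exists)
  have G: "G = cls (p, 1, Z)" unfolding G_def by (rule infinity_point_p[OF assms(7) Z])
  have ker: "kernel E Ep (reduce_point p) = generate E {G}"
    unfolding E_def Ep G by (rule kernel_eq_generate[OF Z])
  interpret E: group E unfolding E_def by (rule group_E)
  have GE: "G \<in> carrier E" unfolding E_def G using Z by (auto simp: carrier_E inf_pt_def)
  have hom: "group_hom E Ep (reduce_point p)" unfolding E_def Ep by (rule reduce_group_hom)
  have surj: "reduce_point p ` carrier E = carrier Ep" unfolding E_def Ep by (rule reduce_surj)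
  let ?H = "subgroup_generated E {G}"
  have H: "carrier ?H = generate E {G}" using GE by (simp add: carrier_subgroup_generated)
  have incl: "(\<lambda>P. P) \<in> hom ?H E"
    using E.generate_in_carrier[of "{G}"] GE by (auto simp: hom_def H subgroup_generated_def)
  have "exact_seq ([Ep, E, ?H], [reduce_point p, \<lambda>P. P])"
    using hom incl ker H by (simp add: group_hom_def group_hom_axioms_def)
  moreover have "reduce_point p \<in> epi E Ep" using hom surj by (simp add: epi_def group_hom_def group_hom_axioms_def)
  moreover have "(\<lambda>P. P) \<in> mon ?H E" using incl by (simp add: mon_def inj_on_def)
  ultimately show ?thesis using GE ker by (simp add: short_exact_sequence_iff)
qed

end
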